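(* Let $G=(V,E)$ be a graph such that $\overline{G}$ does not have a kite as a subgraph. For any total order $\prec$ on $V$, the following inequalities together give a complete characterization of $P^{Co}_{\prec}(G)$ (i.e., $P^{Co}_{\prec}(G)$ is exactly the set of $x\in\mathbb{R}^{|\overline{E}|}$ satisfying all of them): (1) the non-negativity inequalities $x_{uv}\ge 0$ for all $uv\in\overline{E}$, $u\prec v$; (2) the inequalities $\sum_{v\in \bar N^{L}(u)} x_{vu}+\sum_{v\in K}x_{uv}\le 1$ for all $u\in V$ and all cliques $K$ of $G$ with $K\subseteq \bar N^{U}(u)$; (3) the clique-family inequalities applied to $\mathcal{R}^{\prec}_{G}$: for every set $\mathcal{F}=\{K_1,\dots,K_t\}$ of cliques of $\mathcal{R}^{\prec}_{G}$ and every integer $p$ with $1\le p\le t$, with $r = t \bmod p$, $$(p-r-1)\sum_{a\in V_{p-1}}x_a+(p-r)\sum_{a\in V_{\ge p}}x_a\le (p-r)\left\lfloor\frac{t}{p}\right\rfloor ,$$ where $V_{p-1}$ is the set of vertices of $\mathcal{R}^{\prec}_{G}$ covered by exactly $p-1$ cliques of $\mathcal{F}$ and $V_{\ge p}$ is the set of vertices of $\mathcal{R}^{\prec}_{G}$ covered by $p$ or more cliques of $\mathcal{F}$.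
   Context: Graphs are finite and simple. For $G=(V,E)$, $\overline{G}=(V,\overline{E})$ is its complement. Given a total order $\prec$ on $V$ and $u\in V$, let $\bar N^{L}(u)=\{v : uv\in\overline{E},\ v\prec u\}$ and $\bar N^{U}(u)=\{v : uv\in\overline{E},\ u\prec v\}$. Vectors $x\in\mathbb{R}^{|\overline{E}|}$ have one coordinate $x_{uv}$ for each $uv\in\overline{E}$ with $u\prec v$. The representatives constraints are: for every $u\in V$ and every clique $K$ of $G$ with $K\subseteq \bar N^{U}(u)$ (with $K=\emptyset$ allowed), $\sum_{v\in \bar N^{L}(u)} x_{vu}+\sum_{v\in K}x_{uv}\le 1$. $P^{Co}_{\prec}(G)$ is the convex hull of all $x\in\{0,1\}^{|\overline{E}|}$ satisfying all representatives constraints. The graph $\mathcal{R}^{\prec}_{G}$ has vertex set $\overline{E}$, and two distinct elements of $\overline{E}$ are adjacent if and only if their variables both appear in a common representatives constraint. A paw is a triangle plus a fourth vertex adjacent to exactly one vertex of the triangle. A kite is the 5-vertex graph obtained from the paw by adding a new vertex adjacent only to the degree-1 vertex of the paw (a triangle with a pendant path with two edges attached at one of its vertices). "Subgraph" means not necessarily induced. *)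

theory Defs
  imports "HOL-Analysis.Analysis"
begin

type_synonym 'a graph = "'a set \<times> 'a set set"

abbreviation verts :: "'a graph \<Rightarrow> 'a set" where "verts \<equiv> fst"
abbreviation edges :: "'a graph \<Rightarrow> 'a set set" where "edges \<equiv> snd"

definition simple_graph :: "'a graph \<Rightarrow> bool" where
  "simple_graph G \<longleftrightarrow> finite (verts G) \<and> (\<forall>e\<in>edges G. e \<subseteq> verts G \<and> card e = 2)"

definition complement :: "'a graph \<Rightarrow> 'a graph" where
  "complement G = (verts G, {{u, v} | u v. u \<in> verts G \<and> v \<in> verts G \<and> u \<noteq> v \<and> {u, v} \<notin> edges G})"

text \<open>Cliques need not be maximal, and the empty set is a clique.\<close>

definition is_clique :: "'a graph \<Rightarrow> 'a set \<Rightarrow> bool" where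
  "is_clique G K \<longleftrightarrow> K \<subseteq> verts G \<and> (\<forall>u\<in>K. \<forall>v\<in>K. u \<noteq> v \<longrightarrow> {u, v} \<in> edges G)"

text \<open>\<open>G\<close> has a copy of \<open>H\<close> as a not necessarily induced subgraph.\<close>

definition has_subgraph :: "'a graph \<Rightarrow> 'b graph \<Rightarrow> bool" where
  "has_subgraph G H \<longleftrightarrow>
     (\<exists>f. inj_on f (verts H) \<and> f ` verts H \<subseteq> verts G \<and> (\<forall>e\<in>edges H. f ` e \<in> edges G))"

definition paw :: "nat graph" where
  "paw = ({0, 1, 2, 3}, {{0, 1}, {0, 2}, {1, 2}, {2, 3}})"

definition kite :: "nat graph" where
  "kite = (insert 4 (verts paw), insert {3, 4} (edges paw))"

text \<open>A total order on the vertices is given as a strict linear order relation \<open>r\<close>, where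
  \<open>(u, v) \<in> r\<close> means that \<open>u\<close> strictly precedes \<open>v\<close>.\<close>

definition lower_nonnbrs :: "('v \<times> 'v) set \<Rightarrow> 'v graph \<Rightarrow> 'v \<Rightarrow> 'v set" where
  "lower_nonnbrs r G u = {v. {u, v} \<in> edges (complement G) \<and> (v, u) \<in> r}"

definition upper_nonnbrs :: "('v \<times> 'v) set \<Rightarrow> 'v graph \<Rightarrow> 'v \<Rightarrow> 'v set" where
  "upper_nonnbrs r G u = {v. {u, v} \<in> edges (complement G) \<and> (u, v) \<in> r}"

text \<open>A representatives constraint is indexed by a vertex \<open>u\<close> and a clique \<open>K\<close>.\<close>

definition rep_index :: "('v \<times> 'v) set \<Rightarrow> 'v graph \<Rightarrow> 'v \<Rightarrow> 'v set \<Rightarrow> bool" where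
  "rep_index r G u K \<longleftrightarrow> u \<in> verts G \<and> is_clique G K \<and> K \<subseteq> upper_nonnbrs r G u"

text \<open>The coordinate \<open>x\<^sub>u\<^sub>v\<close> (for \<open>u\<close> preceding \<open>v\<close>) is indexed by the unordered pair \<open>{u, v}\<close>.\<close>

definition rep_constraint ::
  "('v::finite \<times> 'v) set \<Rightarrow> 'v graph \<Rightarrow> 'v \<Rightarrow> 'v set \<Rightarrow> real ^ ('v set) \<Rightarrow> bool" where
  "rep_constraint r G u K x \<longleftrightarrow>
     (\<Sum>v\<in>lower_nonnbrs r G u. x $ {v, u}) + (\<Sum>v\<in>K. x $ {u, v}) \<le> 1"

definition rep_variables :: "('v \<times> 'v) set \<Rightarrow> 'v graph \<Rightarrow> 'v \<Rightarrow> 'v set \<Rightarrow> 'v set set" where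
  "rep_variables r G u K = (\<lambda>v. {v, u}) ` lower_nonnbrs r G u \<union> (\<lambda>v. {u, v}) ` K"

text \<open>The space of real vectors indexed by the non-edges of \<open>G\<close>, realised as the coordinate
  subspace of \<open>real ^ ('v set)\<close> of vectors vanishing at all other indices.\<close>

definition nonedge_space :: "'v::finite graph \<Rightarrow> (real ^ ('v set)) set" where
  "nonedge_space G = {x. \<forall>e. e \<notin> edges (complement G) \<longrightarrow> x $ e = 0}"

definition coloring_polytope :: "('v::finite \<times> 'v) set \<Rightarrow> 'v graph \<Rightarrow> (real ^ ('v set)) set" where
  "coloring_polytope r G = convex hull
     {x \<in> nonedge_space G. (\<forall>e\<in>edges (complement G). x $ e \<in> {0, 1}) \<and>
        (\<forall>u K. rep_index r G u K \<longrightarrow> rep_constraint r G u K x)}"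

definition rep_graph :: "('v \<times> 'v) set \<Rightarrow> 'v graph \<Rightarrow> 'v set graph" where
  "rep_graph r G =
     (edges (complement G),
      {{e, f} | e f. e \<in> edges (complement G) \<and> f \<in> edges (complement G) \<and> e \<noteq> f \<and>
         (\<exists>u K. rep_index r G u K \<and> e \<in> rep_variables r G u K \<and> f \<in> rep_variables r G u K)})"

definition covered_exactly :: "'a graph \<Rightarrow> 'a set set \<Rightarrow> nat \<Rightarrow> 'a set" where
  "covered_exactly H F k = {a \<in> verts H. card {K \<in> F. a \<in> K} = k}"

definition covered_at_least :: "'a graph \<Rightarrow> 'a set set \<Rightarrow> nat \<Rightarrow> 'a set" where
  "covered_at_least H F k = {a \<in> verts H. card {K \<in> F. a \<in> K} \<ge> k}"

definition clique_family_ineq ::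
  "'a::finite graph \<Rightarrow> 'a set set \<Rightarrow> nat \<Rightarrow> real ^ 'a \<Rightarrow> bool" where
  "clique_family_ineq H F p x \<longleftrightarrow>
     (let t = card F; r = t mod p in
        (real p - real r - 1) * (\<Sum>a\<in>covered_exactly H F (p - 1). x $ a)
        + (real p - real r) * (\<Sum>a\<in>covered_at_least H F p. x $ a)
        \<le> (real p - real r) * real_of_int \<lfloor>real t / real p\<rfloor>)"

end

theory Submission imports Defs begin

text \<open>
  Write \<open>N\<close> for the set of non-edges of \<open>G\<close>, which are the edges of the complement, and \<open>R\<close> for
  the graph \<open>rep_graph r G\<close> on \<open>N\<close>. Two non-edges are adjacent in \<open>R\<close> if and only if they share a
  vertex \<open>u\<close> and are not the two edges at the least vertex \<open>u\<close> of a triangle of the complement. So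
  \<open>R\<close> is the line graph of the complement in which every triangle has lost one adjacency, and the
  0/1 points of the polytope are the incidence vectors of the stable sets of \<open>R\<close>. Clique-family
  inequalities hold for stable sets by double counting (\<open>clique_family_valid\<close>), so only completeness
  has content.

  Completeness is proved in the dual form that Lovasz used for the matching polytope. By
  \<open>convex_hull_by_tight_inequalities\<close> it is enough to find, for every weight function \<open>w\<close> that is not
  zero on \<open>N\<close>, one inequality of the list, not an equation on the polytope, that all stable sets of
  maximum weight satisfy with equality (\<open>tight_inequality\<close>). If \<open>w e < 0\<close>, no optimal set contains
  \<open>e\<close>, and the non-negativity of \<open>e\<close> serves. Otherwise \<open>w\<close> is non-negative with some positive value,
  and there are two cases.

  \<^item> Some edge of positive weight meets a triangle \<open>T\<close> of the complement. Because there is no kite,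
    the edges meeting \<open>T\<close> form a union of components, so \<open>R\<close> can be restricted to them. If two
    triangles share an edge \<open>ab\<close> and their other two vertices are not joined, every edge of the
    restriction meets \<open>{a, b}\<close>, and \<open>R\<close> is there the union of two cliques. Otherwise all further
    edges of the restriction are pendant at \<open>T\<close>, or it is a complete graph on four vertices; \<open>R\<close> is
    then covered by four cliques, and is essentially the line graph of a four-cycle with pendant
    edges. In both structures a single clique of \<open>R\<close> meets all optimal stable sets
    (\<open>cobipartite_clique\<close>, \<open>four_cliques\<close>), and the clique inequality that it gives, which is the
    clique-family inequality with \<open>t = p = 1\<close>, is tight.

  \<^item> No edge of positive weight meets a triangle. Then optimal stable sets, reduced to the edges of
    positive weight, are maximum weight matchings. If they all cover some vertex \<open>x\<close>, the
    star of \<open>x\<close> is a clique that meets them all. If not, an alternating path argument shows that they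
    miss at most one vertex in each component \<open>U\<close> of the positive edges (\<open>missable.odd_component\<close>);
    so \<open>U\<close> has odd size and every optimal set has \<open>(|U| - 1) / 2\<close> edges inside \<open>U\<close>. This is equality
    in the clique-family inequality with \<open>p = 2\<close> for the family of stars of the vertices of \<open>U\<close>.
\<close>

section \<open>Convex hulls described by tight inequalities\<close>

text \<open>Walk from a relative interior point \<open>z\<close> of the hull towards a point \<open>x\<close> outside; the walk leaves the
  hull at a boundary point \<open>y\<close>, which maximizes some linear functional \<open>c\<close> that is not constant on \<open>V\<close>.
  The point \<open>y\<close> is a convex combination of maximizers of \<open>c\<close>, so an inequality that is tight at all of
  these is tight at \<open>y\<close>. It is strict at \<open>z\<close> and hence violated beyond \<open>y\<close>, in particular at \<open>x\<close>.\<close>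

lemma convex_hull_by_tight_inequalities:
  fixes V S :: "'a::euclidean_space set" and I :: "('a \<times> real) set"
  assumes V: "finite V" "V \<noteq> {}" and aff: "affine hull V = S"
    and tight: "\<And>y z c. y \<in> V \<Longrightarrow> z \<in> V \<Longrightarrow> c \<bullet> y < c \<bullet> z \<Longrightarrow>
      \<exists>(a, b)\<in>I. (\<forall>v\<in>V. (\<forall>v'\<in>V. c \<bullet> v' \<le> c \<bullet> v) \<longrightarrow> a \<bullet> v = b) \<and> (\<exists>v\<in>V. a \<bullet> v < b) \<and> (\<forall>v\<in>V. a \<bullet> v \<le> b)"
    and x: "x \<in> S" "\<And>a b. (a, b) \<in> I \<Longrightarrow> a \<bullet> x \<le> b"
  shows "x \<in> convex hull V"
proof (rule ccontr)
  assume nx: "x \<notin> convex hull V"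
  define P where "P = convex hull V"
  have cP: "compact P" "convex P" "closed P" "bounded P"
    using V finite_imp_compact_convex_hull compact_imp_closed compact_imp_bounded unfolding P_def
    by (auto simp: convex_convex_hull)
  have VP: "V \<subseteq> P" by (simp add: P_def hull_subset)
  have affP: "affine hull P = S" by (simp add: P_def aff)
  have "P \<noteq> {}" using V VP by auto
  then obtain z where z: "z \<in> rel_interior P" using rel_interior_eq_empty cP(2) by blast
  have zP: "z \<in> P" using z rel_interior_subset by blast
  have lz: "x - z \<noteq> 0" using nx zP by (auto simp: P_def)
  obtain d where d: "0 < d" "z + d *\<^sub>R (x - z) \<in> rel_frontier P"
    "\<And>e. \<lbrakk>0 \<le> e; e < d\<rbrakk> \<Longrightarrow> z + e *\<^sub>R (x - z) \<in> rel_interior P"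
    by (rule ray_to_rel_frontier[OF cP(4) z _ lz]) (use x affP in auto)
  define y where "y = z + d *\<^sub>R (x - z)"
  have yP: "y \<in> P" and yr: "y \<notin> rel_interior P"
    using d(2) cP(3) by (auto simp: y_def rel_frontier_def)
  have d1: "d \<le> 1"
  proof (rule ccontr)
    assume "\<not> d \<le> 1"
    hence "z + 1 *\<^sub>R (x - z) \<in> rel_interior P" by (intro d(3)) auto
    thus False using nx rel_interior_subset by (auto simp: P_def)
  qed
  obtain a0 where a0: "a0 \<noteq> 0" "\<And>p. p \<in> P \<Longrightarrow> a0 \<bullet> y \<le> a0 \<bullet> p"
      "\<And>p. p \<in> rel_interior P \<Longrightarrow> a0 \<bullet> y < a0 \<bullet> p"
    using supporting_hyperplane_rel_boundary[OF cP(2) yP yr] by blast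
  define c where "c = - a0"
  have c: "c \<bullet> p \<le> c \<bullet> y" if "p \<in> P" for p using a0(2) that by (simp add: c_def)
  have cz: "c \<bullet> z < c \<bullet> y" using a0(3)[OF z] by (simp add: c_def)
  obtain \<mu> where \<mu>: "\<And>v. v \<in> V \<Longrightarrow> 0 \<le> \<mu> v" "sum \<mu> V = 1" "(\<Sum>v\<in>V. \<mu> v *\<^sub>R v) = y"
    using yP convex_hull_finite[OF V(1)] unfolding P_def by auto
  \<comment> \<open>Only maximizers of \<open>c\<close> can have a positive coefficient in \<open>y\<close>.\<close>
  have maxi: "c \<bullet> v = c \<bullet> y" if v: "v \<in> V" "\<mu> v \<noteq> 0" for v
  proof (rule ccontr)
    assume "c \<bullet> v \<noteq> c \<bullet> y"
    hence lt: "c \<bullet> v < c \<bullet> y" using c[of v] VP v(1) by force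
    have "c \<bullet> y = (\<Sum>v\<in>V. \<mu> v * (c \<bullet> v))"
      using \<mu>(3) by (metis (no_types, lifting) inner_scaleR_right inner_sum_right sum.cong)
    also have "\<dots> < (\<Sum>v\<in>V. \<mu> v * (c \<bullet> y))"
    proof (rule sum_strict_mono_ex1[OF V(1)])
      show "\<forall>v\<in>V. \<mu> v * (c \<bullet> v) \<le> \<mu> v * (c \<bullet> y)" using \<mu>(1) c VP by (auto intro: mult_left_mono)
      show "\<exists>v\<in>V. \<mu> v * (c \<bullet> v) < \<mu> v * (c \<bullet> y)"
        using v lt \<mu>(1)[OF v(1)] by (intro bexI[of _ v]) auto
    qed
    also have "\<dots> = c \<bullet> y" using \<mu>(2) by (simp add: sum_distrib_right[symmetric])
    finally show False by simp
  qed
  have "\<exists>v\<in>V. \<mu> v \<noteq> 0" using \<mu>(2) by (metis sum.neutral zero_neq_one)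
  then obtain v1 where v1: "v1 \<in> V" "c \<bullet> v1 = c \<bullet> y" using maxi by blast
  have "\<exists>v0\<in>V. c \<bullet> v0 < c \<bullet> y"
  proof (rule ccontr)
    assume "\<not> ?thesis"
    hence "V \<subseteq> {p. c \<bullet> p \<ge> c \<bullet> y}" by auto
    hence "P \<subseteq> {p. c \<bullet> p \<ge> c \<bullet> y}" unfolding P_def by (intro hull_minimal convex_halfspace_ge)
    thus False using zP cz by auto
  qed
  then obtain v0 where v0: "v0 \<in> V" "c \<bullet> v0 < c \<bullet> v1" using v1 by auto
  obtain a b where ab: "(a, b) \<in> I" "\<And>v. v \<in> V \<Longrightarrow> (\<And>v'. v' \<in> V \<Longrightarrow> c \<bullet> v' \<le> c \<bullet> v) \<Longrightarrow> a \<bullet> v = b"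
    "\<exists>v\<in>V. a \<bullet> v < b" "\<And>v. v \<in> V \<Longrightarrow> a \<bullet> v \<le> b"
    using tight[OF v0(1) v1(1) v0(2)] by blast
  have "a \<bullet> y = (\<Sum>v\<in>V. \<mu> v * (a \<bullet> v))"
    using \<mu>(3) by (metis (no_types, lifting) inner_scaleR_right inner_sum_right sum.cong)
  also have "\<dots> = (\<Sum>v\<in>V. \<mu> v * b)"
  proof (rule sum.cong[OF refl])
    fix v assume v: "v \<in> V"
    have "a \<bullet> v = b" if "\<mu> v \<noteq> 0"
      by (rule ab(2)[OF v]) (use maxi[OF v that] c VP in auto)
    thus "\<mu> v * (a \<bullet> v) = \<mu> v * b" by auto
  qed
  also have "\<dots> = b" using \<mu>(2) by (simp add: sum_distrib_right[symmetric])
  finally have ay: "a \<bullet> y = b" .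
  have aP: "a \<bullet> p \<le> b" if "p \<in> P" for p
  proof -
    have "P \<subseteq> {p. a \<bullet> p \<le> b}" unfolding P_def using ab(4) by (intro hull_minimal convex_halfspace_le) auto
    thus ?thesis using that by auto
  qed
  have az: "a \<bullet> z < b"
  proof (rule ccontr)
    assume "\<not> ?thesis"
    hence az: "a \<bullet> z = b" using aP[OF zP] by simp
    obtain v where v: "v \<in> V" "a \<bullet> v < b" using ab(3) by blast
    \<comment> \<open>A functional that attains its maximum at a relative interior point is constant: the segment from
      \<open>v\<close> to \<open>z\<close> can be prolonged beyond \<open>z\<close>.\<close>
    have "v \<in> affine hull P" by (meson VP hull_inc subsetD v(1))
    then obtain m where m: "m > 1" "(1 - m) *\<^sub>R v + m *\<^sub>R z \<in> P"
      using convex_rel_interior_if2[OF cP(2) z] by blast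
    have "a \<bullet> ((1 - m) *\<^sub>R v + m *\<^sub>R z) \<le> b" using aP m(2) by blast
    hence "(m - 1) * (b - a \<bullet> v) \<le> 0" using az by (simp add: inner_add_right algebra_simps)
    moreover have "(m - 1) * (b - a \<bullet> v) > 0" using m(1) v(2) by simp
    ultimately show False by linarith
  qed
  have e: "a \<bullet> z + d * (a \<bullet> x - a \<bullet> z) = b"
    using ay by (simp add: y_def inner_add_right inner_diff_right)
  hence "d * (a \<bullet> x - a \<bullet> z) > 0" using az by linarith
  hence pos: "a \<bullet> x - a \<bullet> z > 0" using d(1) zero_less_mult_pos by blast
  have "x \<noteq> y" using nx yP by (auto simp: P_def)
  hence "d \<noteq> 1" by (auto simp: y_def)
  hence "d < 1" using d1 by simp
  hence "d * (a \<bullet> x - a \<bullet> z) < 1 * (a \<bullet> x - a \<bullet> z)" using pos by (rule mult_strict_right_mono)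
  hence "a \<bullet> x > b" using e by simp
  thus False using x(2)[OF ab(1)] by simp
qed

section \<open>Stable sets and clique-family inequalities\<close>

definition stable_set :: "'a graph \<Rightarrow> 'a set \<Rightarrow> bool" where
  "stable_set H S \<longleftrightarrow> S \<subseteq> verts H \<and> (\<forall>u\<in>S. \<forall>v\<in>S. u \<noteq> v \<longrightarrow> {u, v} \<notin> edges H)"

text \<open>The set \<open>C\<close> makes it possible to speak of optimal stable sets in a union of components of \<open>H\<close>.\<close>

definition max_stable :: "'a graph \<Rightarrow> 'a set \<Rightarrow> ('a \<Rightarrow> real) \<Rightarrow> 'a set \<Rightarrow> bool" where
  "max_stable H C w M \<longleftrightarrow> stable_set H M \<and> M \<subseteq> C \<and>
     (\<forall>S. stable_set H S \<and> S \<subseteq> C \<longrightarrow> sum w S \<le> sum w M)"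

definition incidence :: "'a::finite set \<Rightarrow> real ^ 'a" where
  "incidence M = (\<chi> e. if e \<in> M then 1 else 0)"

lemma incidence_nth: "incidence M $ e = (if e \<in> M then 1 else 0)"
  by (simp add: incidence_def)

lemma sum_incidence: "(\<Sum>e\<in>A. incidence M $ e) = real (card (A \<inter> M))"
  by (simp add: incidence_def sum.If_cases)

lemma stable_subset: "stable_set H S \<Longrightarrow> T \<subseteq> S \<Longrightarrow> stable_set H T"
  unfolding stable_set_def by (meson subset_eq)

lemma stable_clique_unique:
  assumes "stable_set H S" "is_clique H K" "x \<in> S" "x \<in> K" "y \<in> S" "y \<in> K"
  shows "x = y"
  using assms unfolding stable_set_def is_clique_def by blast

lemma stable_clique_card:
  fixes S :: "'a::finite set"
  assumes "stable_set H S" "is_clique H K"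
  shows "card (S \<inter> K) \<le> 1"
proof -
  have "\<forall>x\<in>S \<inter> K. \<forall>y\<in>S \<inter> K. x = y"
    using stable_clique_unique[OF assms] by blast
  thus ?thesis by (simp add: card_le_Suc0_iff_eq)
qed

text \<open>The two sides of a clique-family inequality. The left one is kept as a function of \<open>x\<close> because
  equality at given points matters below.\<close>

definition cf_value :: "'a::finite graph \<Rightarrow> 'a set set \<Rightarrow> nat \<Rightarrow> real ^ 'a \<Rightarrow> real" where
  "cf_value H F p x =
     (real p - real (card F mod p) - 1) * (\<Sum>a\<in>covered_exactly H F (p - 1). x $ a)
     + (real p - real (card F mod p)) * (\<Sum>a\<in>covered_at_least H F p. x $ a)"

definition cf_bound :: "'a set set \<Rightarrow> nat \<Rightarrow> real" where
  "cf_bound F p = (real p - real (card F mod p)) * real (card F div p)"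

lemma clique_family_ineq_iff: "clique_family_ineq H F p x \<longleftrightarrow> cf_value H F p x \<le> cf_bound F p"
  by (simp add: clique_family_ineq_def cf_value_def cf_bound_def Let_def floor_divide_of_nat_eq)

text \<open>Let the stable set have \<open>a\<close> elements covered exactly \<open>p - 1\<close> times and \<open>b\<close> elements covered at least
  \<open>p\<close> times. Since a clique contains at most one of its elements, counting incidences gives
  \<open>(p - 1) a + p b \<le> t\<close>. With \<open>t = p q + r\<close> and \<open>a + b = q + k\<close>, this says \<open>a \<ge> p k - r\<close>, which for
  \<open>k \<ge> 1\<close> is enough because \<open>r k \<ge> r\<close>; for \<open>k \<le> 0\<close> the inequality is immediate.\<close>

lemma clique_family_valid:
  fixes H :: "'a::finite graph"
  assumes S: "stable_set H S" and F: "\<forall>K\<in>F. is_clique H K" and p: "1 \<le> p"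
  shows "cf_value H F p (incidence S) \<le> cf_bound F p"
proof -
  define t where "t = card F"
  define q where "q = t div p"
  define r where "r = t mod p"
  define A where "A = covered_exactly H F (p - 1) \<inter> S"
  define B where "B = covered_at_least H F p \<inter> S"
  define a where "a = int (card A)"
  define b where "b = int (card B)"
  have dis: "A \<inter> B = {}"
    using p by (auto simp: A_def B_def covered_exactly_def covered_at_least_def)
  have "(p - 1) * card A + p * card B = (\<Sum>s\<in>A. p - 1) + (\<Sum>s\<in>B. p)" by simp
  also have "\<dots> \<le> (\<Sum>s\<in>A. card {K\<in>F. s \<in> K}) + (\<Sum>s\<in>B. card {K\<in>F. s \<in> K})"
    by (intro add_mono sum_mono) (auto simp: A_def B_def covered_exactly_def covered_at_least_def)
  also have "\<dots> = (\<Sum>s\<in>A\<union>B. card {K\<in>F. s \<in> K})"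
    using dis by (simp add: sum.union_disjoint)
  also have "\<dots> \<le> (\<Sum>s\<in>S. card {K\<in>F. s \<in> K})"
    by (rule sum_mono2) (auto simp: A_def B_def)
  also have "\<dots> = (\<Sum>K\<in>F. card {s\<in>S. s \<in> K})"
    by (rule sum_multicount_gen) auto
  also have "\<dots> \<le> (\<Sum>K\<in>F. 1)"
  proof (rule sum_mono)
    fix K assume "K \<in> F"
    hence "card (S \<inter> K) \<le> 1" using stable_clique_card[OF S] F by blast
    thus "card {s\<in>S. s \<in> K} \<le> 1" by (simp add: Int_def)
  qed
  finally have "(p - 1) * card A + p * card B \<le> t" by (simp add: t_def)
  hence "int ((p - 1) * card A + p * card B) \<le> int t" by (rule zle_int[THEN iffD2])
  hence count: "(int p - 1) * a + int p * b \<le> int t"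
    using p by (simp add: a_def b_def of_nat_diff)
  have tq: "int t = int p * int q + int r"
    by (simp add: q_def r_def flip: of_nat_mult of_nat_add)
  have rp: "int r < int p" using p by (simp add: r_def)
  have a0: "a \<ge> 0" by (simp add: a_def)
  have "(int p - int r - 1) * a + (int p - int r) * b \<le> (int p - int r) * int q"
  proof (cases "a + b \<le> int q")
    case True
    have "(int p - int r) * (a + b) \<le> (int p - int r) * int q"
      using True rp by (intro mult_left_mono) auto
    thus ?thesis using a0 by (simp add: algebra_simps)
  next
    case False
    define k where "k = a + b - int q"
    have k: "k \<ge> 1" using False by (simp add: k_def)
    have b: "b = int q + k - a" by (simp add: k_def)
    have "int p * k - int r \<le> a"
      using count unfolding tq b by (simp add: algebra_simps)
    moreover have "int r * 1 \<le> int r * k" using k by (intro mult_left_mono) auto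
    ultimately show ?thesis unfolding b by (simp add: algebra_simps)
  qed
  hence "real_of_int ((int p - int r - 1) * a + (int p - int r) * b)
      \<le> real_of_int ((int p - int r) * int q)"
    by (rule of_int_le_iff[THEN iffD2])
  thus ?thesis
    by (simp add: cf_value_def cf_bound_def sum_incidence a_def b_def A_def B_def q_def r_def t_def)
qed

lemma cf_value_inner:
  fixes H :: "'a::finite graph"
  obtains c where "\<And>x. cf_value H F p x = c \<bullet> x"
proof
  fix x :: "real ^ 'a"
  have "(\<Sum>a\<in>A. x $ a) = (\<Sum>a\<in>UNIV. (if a \<in> A then 1 else 0) * x $ a)" for A
    by (simp add: sum.If_cases if_distribR if_distrib[of "\<lambda>z. z * _"])
  hence sm: "(\<Sum>a\<in>A. x $ a) = incidence A \<bullet> x" for A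
    by (simp add: inner_vec_def incidence_def)
  show "cf_value H F p x =
      ((real p - real (card F mod p) - 1) *\<^sub>R incidence (covered_exactly H F (p - 1))
       + (real p - real (card F mod p)) *\<^sub>R incidence (covered_at_least H F p)) \<bullet> x"
    unfolding cf_value_def sm by (simp add: inner_add_left)
qed

lemma cf_single:
  fixes H :: "'a::finite graph"
  assumes "is_clique H K" "stable_set H M" "M \<inter> K \<noteq> {}"
  shows "cf_value H {K} 1 (incidence M) = cf_bound {K} 1"
proof -
  have "covered_at_least H {K} 1 = K"
  proof -
    have "{K' \<in> {K}. a \<in> K'} = (if a \<in> K then {K} else {})" for a by auto
    thus ?thesis using assms(1) by (auto simp: covered_at_least_def is_clique_def)
  qed
  moreover have "card (K \<inter> M) = 1"
    using stable_clique_card[OF assms(2,1)] assms(3)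
    by (metis Int_commute One_nat_def Suc_leI card_gt_0_iff finite le_antisym)
  ultimately show ?thesis by (simp add: cf_value_def cf_bound_def sum_incidence)
qed

section \<open>Cliques that meet every stable set of maximum weight\<close>

text \<open>Let \<open>W\<close> be the optimal weight and \<open>K\<close> the set of elements of \<open>X\<close> heavier than \<open>W / 2\<close> and of elements
  of \<open>Y\<close> at least as heavy as \<open>W / 2\<close>. A non-adjacent pair across would weigh more than \<open>W\<close>, so \<open>K\<close> is
  a clique. A stable set has at most one element in \<open>X\<close> and one in \<open>Y\<close>; if it avoids \<open>K\<close>, these
  weigh at most \<open>W / 2\<close> and less than \<open>W / 2\<close>, so it is not optimal.\<close>

lemma cobipartite_clique:
  fixes H :: "'a::finite graph"
  assumes X: "is_clique H X" and Y: "is_clique H Y" and C: "C = X \<union> Y"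
    and w0: "\<forall>e\<in>C. w e \<ge> 0" and pos: "\<exists>e\<in>C. w e > (0::real)"
  shows "\<exists>K. is_clique H K \<and> (\<forall>M. max_stable H C w M \<longrightarrow> M \<inter> K \<noteq> {})"
proof (cases "\<exists>M. max_stable H C w M")
  case True
  then obtain M0 where M0: "max_stable H C w M0" by blast
  define W where "W = sum w M0"
  have le: "sum w S \<le> W" if "stable_set H S" "S \<subseteq> C" for S
    using M0 that by (auto simp: max_stable_def W_def)
  have CV: "C \<subseteq> verts H" using X Y C by (auto simp: is_clique_def)
  obtain e0 where e0: "e0 \<in> C" "w e0 > 0" using pos by blast
  have "sum w {e0} \<le> W" using e0 CV by (intro le) (auto simp: stable_set_def)
  hence W0: "W > 0" using e0 by simp
  define K where "K = {x\<in>X. w x > W / 2} \<union> {y\<in>Y. w y \<ge> W / 2}"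
  have cross: "{x, y} \<in> edges H" if "x \<in> X" "w x > W / 2" "y \<in> Y" "w y \<ge> W / 2" "x \<noteq> y" for x y
  proof (rule ccontr)
    assume "{x, y} \<notin> edges H"
    hence "stable_set H {x, y}" using that CV C by (auto simp: stable_set_def insert_commute)
    hence "sum w {x, y} \<le> W" using that C by (intro le) auto
    thus False using that by simp
  qed
  have "is_clique H K"
    unfolding is_clique_def
  proof (intro conjI ballI impI)
    show "K \<subseteq> verts H" using CV C by (auto simp: K_def)
    fix x y assume xy: "x \<in> K" "y \<in> K" "x \<noteq> y"
    have XX: "{x, y} \<in> edges H" if "x \<in> X" "y \<in> X" using X that xy(3) by (auto simp: is_clique_def)
    have YY: "{x, y} \<in> edges H" if "x \<in> Y" "y \<in> Y" using Y that xy(3) by (auto simp: is_clique_def)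
    show "{x, y} \<in> edges H"
      using xy XX YY cross[of x y] cross[of y x] by (auto simp: K_def insert_commute)
  qed
  moreover have "M \<inter> K \<noteq> {}" if M: "max_stable H C w M" for M
  proof
    assume empty: "M \<inter> K = {}"
    have st: "stable_set H M" and MC: "M \<subseteq> C" and MW: "sum w M = W"
      using M M0 le by (auto simp: max_stable_def W_def intro: antisym)
    have "sum w (M \<inter> X) \<le> W / 2"
    proof (cases "M \<inter> X = {}")
      case False
      then obtain x where x: "x \<in> M" "x \<in> X" by blast
      have "M \<inter> X = {x}" using stable_clique_unique[OF st X] x by blast
      thus ?thesis using x empty by (auto simp: K_def)
    qed (use W0 in simp)
    moreover have "sum w (M - X) < W / 2"
    proof (cases "M - X = {}")
      case False
      then obtain y where y: "y \<in> M" "y \<in> Y" "y \<notin> X" using MC C by blast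
      have "M - X = {y}" using stable_clique_unique[OF st Y] y MC C by blast
      thus ?thesis using y empty by (auto simp: K_def)
    next
      case True
      show ?thesis unfolding True using W0 by simp
    qed
    moreover have "sum w M = sum w (M \<inter> X) + sum w (M - X)"
      by (simp add: sum.Int_Diff)
    ultimately show False using MW by linarith
  qed
  ultimately show ?thesis by blast
qed (use X in blast)

text \<open>Inside a clique \<open>P\<close> the best choice is a heaviest vertex, or nothing if \<open>P\<close> is empty. Treating the
  choice as a set \<open>S\<close> with at most one element covers both cases.\<close>

lemma heaviest_vertex:
  fixes P :: "'a::finite set" and w :: "'a \<Rightarrow> real"
  assumes "\<forall>e\<in>P. w e \<ge> 0"
  obtains S where "S \<subseteq> P" "\<And>x y. x \<in> S \<Longrightarrow> y \<in> S \<Longrightarrow> x = y" "sum w S \<ge> 0"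
    "\<And>T. T \<subseteq> P \<Longrightarrow> (\<And>x y. x \<in> T \<Longrightarrow> y \<in> T \<Longrightarrow> x = y) \<Longrightarrow> sum w T \<le> sum w S"
proof (cases "P = {}")
  case True
  thus ?thesis using that[of "{}"] by auto
next
  case False
  have "finite (w ` P)" "w ` P \<noteq> {}" using False by auto
  hence "Max (w ` P) \<in> w ` P" by (rule Max_in)
  then obtain e where e: "e \<in> P" "w e = Max (w ` P)" by auto
  have mx: "w x \<le> w e" if "x \<in> P" for x using that by (simp add: e(2))
  show ?thesis
  proof (rule that[of "{e}"])
    fix T assume T: "T \<subseteq> P" "\<And>x y. x \<in> T \<Longrightarrow> y \<in> T \<Longrightarrow> x = y"
    show "sum w T \<le> sum w {e}"
    proof (cases "T = {}")
      case True
      thus ?thesis using e(1) assms by simp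
    next
      case False
      then obtain x where "x \<in> T" by blast
      hence "T = {x}" using T(2) by blast
      thus ?thesis using mx T(1) by simp
    qed
  qed (use e assms in auto)
qed

text \<open>Here \<open>a\<close>, \<open>b\<close>, \<open>c\<close>, \<open>p\<close>, \<open>q\<close>, \<open>s\<close> stand for the weights of the vertices \<open>a\<close>, \<open>b\<close>, \<open>c\<close> and of
  heaviest vertices of \<open>Pu\<close>, \<open>Pv\<close>, \<open>Pw\<close> in the next lemma, and \<open>W\<close> for the optimum. The upper bounds
  come from the maximal stable sets; \<open>Q1\<close> to \<open>Q4\<close> list the ways in which an optimal stable set can
  avoid each of the four cliques.\<close>

lemma four_cliques_arith:
  fixes W a b c p q s :: real
  assumes "W > 0" "a \<ge> 0" "b \<ge> 0" "c \<ge> 0" "p \<ge> 0" "q \<ge> 0" "s \<ge> 0"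
    and "a + c \<le> W" "a + s \<le> W" "c + q \<le> W" "b + p \<le> W" "p + q + s \<le> W"
    and Q1: "W \<le> b \<or> W \<le> c + q \<or> W \<le> q + s"
    and Q2: "W \<le> b \<or> W \<le> a + s \<or> W \<le> q + s"
    and Q3: "W \<le> c \<or> W \<le> p + s"
    and Q4: "W \<le> a \<or> W \<le> p + q"
  shows False
  using assms by argo

text \<open>Regard the four cliques as vertices and the elements of \<open>C\<close> as edges that join the cliques
  containing them: \<open>a\<close>, \<open>b\<close>, \<open>c\<close> are three sides of a four-cycle, \<open>Pu\<close> is its (possibly multiple or
  missing) fourth side, and \<open>Pv\<close>, \<open>Pw\<close> are pendant edges. The stable sets are the matchings of this bipartite
  multigraph, and the claim is that all maximum weight matchings cover a common vertex. With so few
  vertices this reduces to \<open>four_cliques_arith\<close>.\<close>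

lemma four_cliques:
  fixes H :: "'a::finite graph"
  assumes C: "C = {a, b, c} \<union> Pu \<union> Pv \<union> Pw" and CV: "C \<subseteq> verts H"
    and dist: "a \<noteq> b" "a \<noteq> c" "b \<noteq> c" "{a, b, c} \<inter> (Pu \<union> Pv \<union> Pw) = {}"
      "Pu \<inter> Pv = {}" "Pu \<inter> Pw = {}" "Pv \<inter> Pw = {}"
    and Q: "is_clique H (insert a Pu)" "is_clique H (insert c Pu)"
      "is_clique H ({a, b} \<union> Pv)" "is_clique H ({b, c} \<union> Pw)"
    and non: "{a, c} \<notin> edges H" "\<forall>x\<in>Pw. {a, x} \<notin> edges H" "\<forall>x\<in>Pv. {c, x} \<notin> edges H"
      "\<forall>x\<in>Pu. {b, x} \<notin> edges H" "\<forall>x\<in>Pu. \<forall>y\<in>Pv. {x, y} \<notin> edges H"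
      "\<forall>x\<in>Pu. \<forall>y\<in>Pw. {x, y} \<notin> edges H" "\<forall>x\<in>Pv. \<forall>y\<in>Pw. {x, y} \<notin> edges H"
    and w0: "\<forall>e\<in>C. w e \<ge> 0" and pos: "\<exists>e\<in>C. w e > (0::real)"
  shows "\<exists>K. is_clique H K \<and> (\<forall>M. max_stable H C w M \<longrightarrow> M \<inter> K \<noteq> {})"
proof (rule ccontr)
  assume neg: "\<not> ?thesis"
  obtain M1 where M1: "max_stable H C w M1" "M1 \<inter> insert a Pu = {}" using neg Q(1) by blast
  obtain M2 where M2: "max_stable H C w M2" "M2 \<inter> insert c Pu = {}" using neg Q(2) by blast
  obtain M3 where M3: "max_stable H C w M3" "M3 \<inter> ({a, b} \<union> Pv) = {}" using neg Q(3) by blast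
  obtain M4 where M4: "max_stable H C w M4" "M4 \<inter> ({b, c} \<union> Pw) = {}" using neg Q(4) by blast
  define W where "W = sum w M1"
  have W: "sum w M = W" if "max_stable H C w M" for M
    using that M1(1) by (force simp: max_stable_def W_def)
  have le: "sum w S \<le> W" if "stable_set H S" "S \<subseteq> C" for S
    using M1 that by (auto simp: max_stable_def W_def)
  obtain Su where Su: "Su \<subseteq> Pu" "\<And>x y. x \<in> Su \<Longrightarrow> y \<in> Su \<Longrightarrow> x = y" "sum w Su \<ge> 0"
    "\<And>T. T \<subseteq> Pu \<Longrightarrow> (\<And>x y. x \<in> T \<Longrightarrow> y \<in> T \<Longrightarrow> x = y) \<Longrightarrow> sum w T \<le> sum w Su"
    by (rule heaviest_vertex[of Pu w]) (use w0 C in auto)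
  obtain Sv where Sv: "Sv \<subseteq> Pv" "\<And>x y. x \<in> Sv \<Longrightarrow> y \<in> Sv \<Longrightarrow> x = y" "sum w Sv \<ge> 0"
    "\<And>T. T \<subseteq> Pv \<Longrightarrow> (\<And>x y. x \<in> T \<Longrightarrow> y \<in> T \<Longrightarrow> x = y) \<Longrightarrow> sum w T \<le> sum w Sv"
    by (rule heaviest_vertex[of Pv w]) (use w0 C in auto)
  obtain Sw where Sw: "Sw \<subseteq> Pw" "\<And>x y. x \<in> Sw \<Longrightarrow> y \<in> Sw \<Longrightarrow> x = y" "sum w Sw \<ge> 0"
    "\<And>T. T \<subseteq> Pw \<Longrightarrow> (\<And>x y. x \<in> T \<Longrightarrow> y \<in> T \<Longrightarrow> x = y) \<Longrightarrow> sum w T \<le> sum w Sw"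
    by (rule heaviest_vertex[of Pw w]) (use w0 C in auto)
  define p q s where "p = sum w Su" and "q = sum w Sv" and "s = sum w Sw"
  have st: "stable_set H S" if "S \<subseteq> C" "\<And>x y. x \<in> S \<Longrightarrow> y \<in> S \<Longrightarrow> x \<noteq> y \<Longrightarrow> {x, y} \<notin> edges H" for S
    using that CV by (auto simp: stable_set_def)
  have nin: "a \<notin> Su" "a \<notin> Sv" "a \<notin> Sw" "b \<notin> Su" "b \<notin> Sv" "b \<notin> Sw" "c \<notin> Su" "c \<notin> Sv" "c \<notin> Sw"
    using dist(4) Su(1) Sv(1) Sw(1) by auto
  have sub: "Su \<subseteq> C" "Sv \<subseteq> C" "Sw \<subseteq> C" "a \<in> C" "b \<in> C" "c \<in> C"
    using Su(1) Sv(1) Sw(1) C by auto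
  have disj: "Su \<inter> Sv = {}" "(Su \<union> Sv) \<inter> Sw = {}" using dist(5-7) Su(1) Sv(1) Sw(1) by auto
  have ac: "w a + w c \<le> W"
  proof -
    have "sum w {a, c} \<le> W"
      by (rule le[OF st]) (use sub non(1) in \<open>auto simp: insert_commute\<close>)
    thus ?thesis using dist by simp
  qed
  have as: "w a + s \<le> W"
  proof -
    have n: "\<forall>x\<in>Sw. {a, x} \<notin> edges H \<and> {x, a} \<notin> edges H"
      using non(2) Sw(1) by (auto simp: insert_commute)
    have "sum w (insert a Sw) \<le> W"
      by (rule le[OF st]) (use sub n Sw(2) in auto)
    thus ?thesis using nin by (simp add: s_def)
  qed
  have cq: "w c + q \<le> W"
  proof -
    have n: "\<forall>x\<in>Sv. {c, x} \<notin> edges H \<and> {x, c} \<notin> edges H"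
      using non(3) Sv(1) by (auto simp: insert_commute)
    have "sum w (insert c Sv) \<le> W"
      by (rule le[OF st]) (use sub n Sv(2) in auto)
    thus ?thesis using nin by (simp add: q_def)
  qed
  have bp: "w b + p \<le> W"
  proof -
    have n: "\<forall>x\<in>Su. {b, x} \<notin> edges H \<and> {x, b} \<notin> edges H"
      using non(4) Su(1) by (auto simp: insert_commute)
    have "sum w (insert b Su) \<le> W"
      by (rule le[OF st]) (use sub n Su(2) in auto)
    thus ?thesis using nin by (simp add: p_def)
  qed
  have uv: "{x, y} \<notin> edges H" "{y, x} \<notin> edges H" if "x \<in> Su" "y \<in> Sv" for x y
    using that non(5) Su(1) Sv(1) by (auto simp: insert_commute)
  have uw: "{x, y} \<notin> edges H" "{y, x} \<notin> edges H" if "x \<in> Su" "y \<in> Sw" for x y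
    using that non(6) Su(1) Sw(1) by (auto simp: insert_commute)
  have vw: "{x, y} \<notin> edges H" "{y, x} \<notin> edges H" if "x \<in> Sv" "y \<in> Sw" for x y
    using that non(7) Sv(1) Sw(1) by (auto simp: insert_commute)
  have "sum w (Su \<union> Sv \<union> Sw) \<le> W"
  proof (rule le[OF st])
    fix x y assume "x \<in> Su \<union> Sv \<union> Sw" "y \<in> Su \<union> Sv \<union> Sw" "x \<noteq> y"
    thus "{x, y} \<notin> edges H" using uv uw vw Su(2) Sv(2) Sw(2) by (elim UnE) auto
  qed (use sub in auto)
  hence pqs: "p + q + s \<le> W"
    using disj by (simp add: sum.union_disjoint p_def q_def s_def)
  have split: "W = sum w (M \<inter> {a}) + sum w (M \<inter> {b}) + sum w (M \<inter> {c})
      + sum w (M \<inter> Pu) + sum w (M \<inter> Pv) + sum w (M \<inter> Pw)" if "max_stable H C w M" for M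
  proof -
    have "M = (M \<inter> {a}) \<union> (M \<inter> {b}) \<union> (M \<inter> {c}) \<union> (M \<inter> Pu) \<union> (M \<inter> Pv) \<union> (M \<inter> Pw)"
      using that C by (auto simp: max_stable_def)
    hence "sum w M = sum w ((M \<inter> {a}) \<union> (M \<inter> {b}) \<union> (M \<inter> {c}) \<union> (M \<inter> Pu) \<union> (M \<inter> Pv) \<union> (M \<inter> Pw))"
      by (rule arg_cong)
    also have "\<dots> = sum w (M \<inter> {a}) + sum w (M \<inter> {b}) + sum w (M \<inter> {c})
      + sum w (M \<inter> Pu) + sum w (M \<inter> Pv) + sum w (M \<inter> Pw)"
      using dist by (subst sum.union_disjoint, auto)+
    finally show ?thesis using W[OF that] by simp
  qed
  have un: "x = y" if "max_stable H C w M" "is_clique H K" "x \<in> M" "x \<in> K" "y \<in> M" "y \<in> K" for M K x y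
    using that by (metis max_stable_def stable_clique_unique)
  have bu: "sum w (M \<inter> Pu) \<le> p" if "max_stable H C w M" for M
    unfolding p_def
    using Su(4)[of "M \<inter> Pu"] un[OF that Q(1)] by (meson IntD1 IntD2 UnI2 inf_le2 insertI2)
  have bv: "sum w (M \<inter> Pv) \<le> q" if "max_stable H C w M" for M
    unfolding q_def
    using Sv(4)[of "M \<inter> Pv"] un[OF that Q(3)] by (meson IntD1 IntD2 UnI2 inf_le2 insertI2)
  have bw: "sum w (M \<inter> Pw) \<le> s" if "max_stable H C w M" for M
    unfolding s_def
    using Sw(4)[of "M \<inter> Pw"] un[OF that Q(4)] by (meson IntD1 IntD2 UnI2 inf_le2 insertI2)
  have Q34: "M \<inter> {a} = {} \<and> M \<inter> {c} = {} \<and> M \<inter> Pv = {} \<and> M \<inter> Pw = {}"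
    if M: "max_stable H C w M" "b \<in> M" for M
    using un[OF M(1) Q(3) M(2)] un[OF M(1) Q(4) M(2)] dist by auto
  have Qc: "M \<inter> Pw = {} \<and> M \<inter> Pu = {}" if M: "max_stable H C w M" "c \<in> M" for M
    using un[OF M(1) Q(4) M(2)] un[OF M(1) Q(2) M(2)] dist by auto
  have Qa: "M \<inter> Pv = {} \<and> M \<inter> Pu = {}" if M: "max_stable H C w M" "a \<in> M" for M
    using un[OF M(1) Q(3) M(2)] un[OF M(1) Q(1) M(2)] dist by auto
  have one: "W \<le> w b \<or> W \<le> w c + q \<or> W \<le> q + s"
  proof -
    have e: "M1 \<inter> {a} = {}" "M1 \<inter> Pu = {}" using M1(2) by auto
    show ?thesis
      using split[OF M1(1)] bv[OF M1(1)] bw[OF M1(1)] Q34[OF M1(1)] Qc[OF M1(1)] e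
      by (cases "b \<in> M1"; cases "c \<in> M1") auto
  qed
  have two: "W \<le> w b \<or> W \<le> w a + s \<or> W \<le> q + s"
  proof -
    have e: "M2 \<inter> {c} = {}" "M2 \<inter> Pu = {}" using M2(2) by auto
    show ?thesis
      using split[OF M2(1)] bv[OF M2(1)] bw[OF M2(1)] Q34[OF M2(1)] Qa[OF M2(1)] e
      by (cases "b \<in> M2"; cases "a \<in> M2") auto
  qed
  have three: "W \<le> w c \<or> W \<le> p + s"
  proof -
    have e: "M3 \<inter> {a} = {}" "M3 \<inter> {b} = {}" "M3 \<inter> Pv = {}" using M3(2) by auto
    show ?thesis
      using split[OF M3(1)] bu[OF M3(1)] bw[OF M3(1)] Qc[OF M3(1)] e
      by (cases "c \<in> M3") auto
  qed
  have four: "W \<le> w a \<or> W \<le> p + q"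
  proof -
    have e: "M4 \<inter> {b} = {}" "M4 \<inter> {c} = {}" "M4 \<inter> Pw = {}" using M4(2) by auto
    show ?thesis
      using split[OF M4(1)] bu[OF M4(1)] bv[OF M4(1)] Qa[OF M4(1)] e
      by (cases "a \<in> M4") auto
  qed
  obtain e0 where e0: "e0 \<in> C" "w e0 > 0" using pos by blast
  have "sum w {e0} \<le> W" using e0 CV by (intro le) (auto simp: stable_set_def)
  hence W0: "W > 0" using e0 by simp
  show False
    by (rule four_cliques_arith[OF W0 _ _ _ _ _ _ ac as cq bp pqs one two three four])
      (use w0 sub Su(3) Sv(3) Sw(3) in \<open>auto simp: p_def q_def s_def\<close>)
qed

section \<open>Matchings of maximum weight\<close>

definition matching :: "'v set set \<Rightarrow> bool" where
  "matching M \<longleftrightarrow> (\<forall>e\<in>M. card e = 2) \<and> (\<forall>e\<in>M. \<forall>f\<in>M. e \<noteq> f \<longrightarrow> e \<inter> f = {})"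

text \<open>A matching as an involution that fixes exactly the uncovered vertices. In this form the component
  of a vertex in the union of two matchings is an orbit of two involutions.\<close>

definition partner :: "'v set set \<Rightarrow> 'v \<Rightarrow> 'v" where
  "partner M v = (if v \<in> \<Union>M then THE x. {v, x} \<in> M else v)"

lemma matching_unique: "matching M \<Longrightarrow> {v, x} \<in> M \<Longrightarrow> {v, y} \<in> M \<Longrightarrow> x = y"
  unfolding matching_def by (metis disjoint_iff doubleton_eq_iff insertI1)

lemma partner_eq: "matching M \<Longrightarrow> {v, x} \<in> M \<Longrightarrow> partner M v = x"
  unfolding partner_def using matching_unique[of M v] by (auto intro!: the_equality)

lemma partner_uncovered: "v \<notin> \<Union>M \<Longrightarrow> partner M v = v"
  by (simp add: partner_def)

lemma matching_edge:
  assumes "matching M" "e \<in> M" "v \<in> e"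
  obtains x where "e = {v, x}" "x \<noteq> v"
proof -
  have "card e = 2" using assms by (simp add: matching_def)
  then obtain x y where "e = {x, y}" "x \<noteq> y" by (auto simp: card_2_iff)
  thus ?thesis using assms(3) that by (auto simp: insert_commute)
qed

lemma partner_covered:
  assumes "matching M" "v \<in> \<Union>M"
  shows "{v, partner M v} \<in> M" "partner M v \<noteq> v"
proof -
  obtain e where e: "e \<in> M" "v \<in> e" using assms(2) by blast
  obtain x where x: "e = {v, x}" "x \<noteq> v" using matching_edge[OF assms(1) e] .
  have "partner M v = x" using partner_eq[OF assms(1)] e(1) x(1) by simp
  thus "{v, partner M v} \<in> M" "partner M v \<noteq> v" using x e by auto
qed

lemma partner_partner: "matching M \<Longrightarrow> partner M (partner M v) = v"
  by (metis insert_commute partner_covered(1) partner_eq partner_uncovered)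

lemma partner_closed:
  assumes "matching M" "\<forall>x\<in>C. partner M x \<in> C" "e \<in> M"
  shows "e \<subseteq> C \<or> e \<inter> C = {}"
proof (cases "e \<inter> C = {}")
  case False
  then obtain v where v: "v \<in> e" "v \<in> C" by blast
  obtain x where x: "e = {v, x}" "x \<noteq> v" using matching_edge[OF assms(1,3) v(1)] .
  have "partner M v = x" using partner_eq[OF assms(1)] assms(3) x(1) by simp
  thus ?thesis using assms(2) v x by auto
qed simp

text \<open>The component of \<open>t\<close> in the union of two matchings is a path that ends at \<open>t\<close>, because \<open>M2\<close> misses
  \<open>t\<close>. A vertex missed by \<open>M1\<close> is an end of its component, so the path can
  contain at most one of \<open>u\<close> and \<open>v\<close>, as its other end.\<close>

lemma alternating_component:
  assumes M1: "matching M1" and M2: "matching M2" and t: "t \<notin> \<Union>M2"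
    and u: "u \<notin> \<Union>M1" and v: "v \<notin> \<Union>M1" and uv: "u \<noteq> v"
  obtains C where "t \<in> C" "\<And>e. e \<in> M1 \<union> M2 \<Longrightarrow> e \<subseteq> C \<or> e \<inter> C = {}" "u \<notin> C \<or> v \<notin> C"
proof -
  note component = that
  define f where "f = partner M1"
  define g where "g = partner M2"
  \<comment> \<open>The path is \<open>b 0, f (b 0), b 1, f (b 1), \<dots>\<close>, starting with an edge of \<open>M1\<close>.\<close>
  define b where "b k = ((g \<circ> f) ^^ k) t" for k
  have ff: "f (f x) = x" and gg: "g (g x) = x" for x
    using partner_partner M1 M2 by (auto simp: f_def g_def)
  have b0: "b 0 = t" and bS: "b (Suc k) = g (f (b k))" for k by (simp_all add: b_def)
  have gt: "g t = t" using t by (simp add: g_def partner_uncovered)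
  have gbS: "g (b (Suc k)) = f (b k)" for k by (simp add: bS gg)
  have fu: "f u = u" and fv: "f v = v" using u v by (auto simp: f_def partner_uncovered)
  have fixed: "x = b k" if "f x = x" "x \<in> {b k, f (b k)}" for x k
    using that ff by force
  have main: thesis if C: "t \<in> C" "\<forall>x\<in>C. f x \<in> C" "\<forall>x\<in>C. g x \<in> C" "u \<notin> C \<or> v \<notin> C" for C
  proof (rule component[of C])
    fix e assume "e \<in> M1 \<union> M2"
    thus "e \<subseteq> C \<or> e \<inter> C = {}"
      using partner_closed[OF M1] partner_closed[OF M2] C unfolding f_def g_def by blast
  qed (use C in auto)
  show thesis
  proof (cases "\<exists>k. b k \<in> {u, v}")
    case False
    let ?C = "\<Union>k. {b k, f (b k)}"
    show thesis
    proof (rule main[of ?C])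
      show "t \<in> ?C" using b0 by blast
      show "\<forall>x\<in>?C. f x \<in> ?C" using ff by auto
      have "g (b k) \<in> ?C" for k using gt gbS b0 by (cases k) auto
      moreover have "g (f (b k)) \<in> ?C" for k using bS[of k] by (metis UNIV_I UN_I insertI1)
      ultimately show "\<forall>x\<in>?C. g x \<in> ?C" by blast
      have "u \<noteq> b k" for k using False by blast
      thus "u \<notin> ?C \<or> v \<notin> ?C" using fixed[OF fu] by blast
    qed
  next
    case True
    \<comment> \<open>At the first visit to \<open>u\<close> or \<open>v\<close> the path stops, so its vertices up to there are closed under
      both involutions.\<close>
    define k where "k = (LEAST k. b k \<in> {u, v})"
    have k: "b k \<in> {u, v}" unfolding k_def using True by (rule LeastI_ex)
    have less: "b j \<notin> {u, v}" if "j < k" for j using not_less_Least that unfolding k_def by blast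
    have fk: "f (b k) = b k" using k fu fv by auto
    let ?C = "\<Union>j\<in>{..k}. {b j, f (b j)}"
    show thesis
    proof (rule main[of ?C])
      show "t \<in> ?C" using b0 by blast
      show "\<forall>x\<in>?C. f x \<in> ?C" using ff by auto
      have 1: "g (b j) \<in> ?C" if "j \<le> k" for j
      proof (cases j)
        case 0
        thus ?thesis using gt b0 by auto
      next
        case (Suc i)
        hence "g (b j) = f (b i)" "i \<le> k" using gbS that by auto
        thus ?thesis by blast
      qed
      have 2: "g (f (b j)) \<in> ?C" if "j \<le> k" for j
      proof (cases "j = k")
        case True
        thus ?thesis using 1 fk by simp
      next
        case False
        hence "g (f (b j)) = b (Suc j)" "Suc j \<le> k" using bS that by auto
        thus ?thesis by blast
      qed
      show "\<forall>x\<in>?C. g x \<in> ?C" using 1 2 by blast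
      have eq: "x = b k" if x: "x \<in> {u, v}" "x \<in> ?C" for x
      proof -
        obtain j where j: "j \<le> k" "x \<in> {b j, f (b j)}" using x(2) by blast
        have "x = b j" using fixed[OF _ j(2)] x(1) fu fv by auto
        thus ?thesis using less[of j] j(1) x(1) by (cases "j = k") auto
      qed
      show "u \<notin> ?C \<or> v \<notin> ?C"
      proof (rule ccontr)
        assume "\<not> ?thesis"
        hence "u \<in> ?C" "v \<in> ?C" by simp_all
        hence "u = b k" "v = b k" using eq[of u] eq[of v] by simp_all
        thus False using uv by simp
      qed
    qed
  qed
qed

definition max_matching :: "'v set set \<Rightarrow> ('v set \<Rightarrow> real) \<Rightarrow> 'v set set \<Rightarrow> bool" where
  "max_matching D w M \<longleftrightarrow> matching M \<and> M \<subseteq> D \<and>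
     (\<forall>M'. matching M' \<and> M' \<subseteq> D \<longrightarrow> sum w M' \<le> sum w M)"

lemma matching_swap:
  assumes "matching M1" "matching M2" "\<And>e. e \<in> M1 \<union> M2 \<Longrightarrow> e \<subseteq> C \<or> e \<inter> C = {}"
  shows "matching ({e\<in>M1. \<not> e \<subseteq> C} \<union> {e\<in>M2. e \<subseteq> C})"
  unfolding matching_def
proof (intro conjI ballI impI)
  fix e f assume e: "e \<in> {e\<in>M1. \<not> e \<subseteq> C} \<union> {e\<in>M2. e \<subseteq> C}"
    and f: "f \<in> {e\<in>M1. \<not> e \<subseteq> C} \<union> {e\<in>M2. e \<subseteq> C}" and ef: "e \<noteq> f"
  have 1: "e \<inter> f = {}" if "e \<in> M1" "f \<in> M1" using assms(1) that ef by (auto simp: matching_def)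
  have 2: "e \<inter> f = {}" if "e \<in> M2" "f \<in> M2" using assms(2) that ef by (auto simp: matching_def)
  show "e \<inter> f = {}" using e f 1 2 assms(3)[of e] assms(3)[of f] by blast
qed (use assms(1,2) in \<open>auto simp: matching_def\<close>)

text \<open>Exchanging the two matchings inside \<open>C\<close> gives two matchings with the same total weight, so both
  remain optimal.\<close>

lemma max_matching_swap:
  fixes M1 M2 :: "'v::finite set set"
  assumes M1: "max_matching D w M1" and M2: "max_matching D w M2"
    and C: "\<And>e. e \<in> M1 \<union> M2 \<Longrightarrow> e \<subseteq> C \<or> e \<inter> C = {}"
  shows "max_matching D w ({e\<in>M1. \<not> e \<subseteq> C} \<union> {e\<in>M2. e \<subseteq> C})"
proof -
  define N1 where "N1 = {e\<in>M1. \<not> e \<subseteq> C} \<union> {e\<in>M2. e \<subseteq> C}"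
  define N2 where "N2 = {e\<in>M2. \<not> e \<subseteq> C} \<union> {e\<in>M1. e \<subseteq> C}"
  have m: "matching M1" "matching M2" using M1 M2 by (auto simp: max_matching_def)
  have n: "matching N1" "matching N2" "N1 \<subseteq> D" "N2 \<subseteq> D"
    unfolding N1_def N2_def using matching_swap[OF m C] matching_swap[OF m(2,1), of C] C M1 M2
    by (auto simp: max_matching_def)
  have s: "sum w ({e\<in>A. \<not> e \<subseteq> C} \<union> {e\<in>B. e \<subseteq> C})
      = sum w {e\<in>A. \<not> e \<subseteq> C} + sum w {e\<in>B. e \<subseteq> C}" for A B
    by (rule sum.union_disjoint) auto
  have d: "sum w A = sum w {e\<in>A. \<not> e \<subseteq> C} + sum w {e\<in>A. e \<subseteq> C}" for A
  proof -
    have "A = {e\<in>A. \<not> e \<subseteq> C} \<union> {e\<in>A. e \<subseteq> C}" by blast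
    thus ?thesis using s[of A A] by simp
  qed
  have "sum w N1 + sum w N2 = sum w M1 + sum w M2"
    unfolding N1_def N2_def s d[of M1] d[of M2] by simp
  moreover have "sum w N2 \<le> sum w M2" using M2 n by (auto simp: max_matching_def)
  ultimately have "sum w M1 \<le> sum w N1" by linarith
  hence "max_matching D w N1" using M1 n unfolding max_matching_def by (meson order_trans)
  thus ?thesis by (simp add: N1_def)
qed

lemma max_matching_no_free_edge:
  fixes M :: "'v::finite set set"
  assumes M: "max_matching D w M" and e: "{x, y} \<in> D" "x \<noteq> y" "w {x, y} > 0"
  shows "x \<in> \<Union>M \<or> y \<in> \<Union>M"
proof (rule ccontr)
  assume n: "\<not> ?thesis"
  hence "matching (insert {x, y} M)"
    using M e(2) by (auto simp: max_matching_def matching_def)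
  hence "sum w (insert {x, y} M) \<le> sum w M"
    using M e(1) by (auto simp: max_matching_def)
  moreover have "{x, y} \<notin> M" using n by blast
  ultimately show False using e(3) by simp
qed

text \<open>The situation in which no star is met by all maximum weight matchings; it forces an odd
  component in which each of these matchings leaves exactly one vertex uncovered.\<close>

locale missable =
  fixes D :: "'v::finite set set" and w :: "'v set \<Rightarrow> real"
  assumes card2: "e \<in> D \<Longrightarrow> card e = 2" and positive: "e \<in> D \<Longrightarrow> w e > 0"
    and missed: "x \<in> \<Union>D \<Longrightarrow> \<exists>M. max_matching D w M \<and> x \<notin> \<Union>M"
begin

definition linked :: "('v \<times> 'v) set" where
  "linked = {(x, y). {x, y} \<in> D}\<^sup>*"

lemma free_edge: "max_matching D w M \<Longrightarrow> {x, y} \<in> D \<Longrightarrow> x \<in> \<Union>M \<or> y \<in> \<Union>M"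
proof -
  assume M: "max_matching D w M" and e: "{x, y} \<in> D"
  have "x \<noteq> y" using card2[OF e] by auto
  thus ?thesis using max_matching_no_free_edge[OF M e] positive[OF e] by blast
qed

text \<open>Induction along a path from \<open>u\<close> to \<open>v\<close>, with last edge \<open>tv\<close>. If \<open>M\<close> misses \<open>u\<close> and \<open>v\<close>, it covers \<open>t\<close>,
  as otherwise \<open>tv\<close> could be added. Exchange \<open>M\<close> with an optimal matching missing \<open>t\<close> on the component
  of \<open>t\<close>. The result is optimal, misses \<open>t\<close>, and still misses \<open>u\<close> or \<open>v\<close>; the former contradicts the
  induction hypothesis, the latter leaves the edge \<open>tv\<close> free.\<close>

lemma at_most_one_missed:
  assumes "(u, v) \<in> linked" "max_matching D w M" "u \<notin> \<Union>M" "v \<notin> \<Union>M"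
  shows "u = v"
  using assms unfolding linked_def
proof (induction arbitrary: M rule: rtrancl_induct)
  case base
  show ?case by simp
next
  case (step t v)
  have tv: "{t, v} \<in> D" using step.hyps by simp
  show ?case
  proof (rule ccontr)
    assume uv: "u \<noteq> v"
    have tM: "t \<in> \<Union>M" using free_edge[OF step.prems(1) tv] step.prems(3) by blast
    obtain M2 where M2: "max_matching D w M2" "t \<notin> \<Union>M2" using missed[of t] tv by auto
    have m: "matching M" "matching M2" using step.prems(1) M2(1) by (auto simp: max_matching_def)
    obtain C where C: "t \<in> C" "\<And>e. e \<in> M \<union> M2 \<Longrightarrow> e \<subseteq> C \<or> e \<inter> C = {}" "u \<notin> C \<or> v \<notin> C"
      using alternating_component[OF m M2(2) step.prems(2,3) uv] by blast
    define M' where "M' = {e\<in>M. \<not> e \<subseteq> C} \<union> {e\<in>M2. e \<subseteq> C}"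
    have M': "max_matching D w M'"
      unfolding M'_def by (rule max_matching_swap[OF step.prems(1) M2(1) C(2)])
    have t': "t \<notin> \<Union>M'" using M2(2) C(1,2) by (auto simp: M'_def)
    show False
    proof (cases "u \<in> C")
      case False
      hence "u \<notin> \<Union>M'" using step.prems(2) by (auto simp: M'_def)
      hence "u = t" using step.IH[OF M'] t' by blast
      thus False using tM step.prems(2) by simp
    next
      case True
      hence "v \<notin> \<Union>M'" using step.prems(3) C(3) by (auto simp: M'_def)
      thus False using free_edge[OF M' tv] t' by blast
    qed
  qed
qed

text \<open>Take for \<open>U\<close> a component. An optimal matching leaves at most one vertex of \<open>U\<close> uncovered, and
  some optimal matching leaves a given vertex of \<open>U\<close> uncovered, which makes \<open>|U|\<close> odd.\<close>

lemma odd_component: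
  assumes "D \<noteq> {}"
  obtains U where "U \<subseteq> \<Union>D" "odd (card U)" "card U \<ge> 3"
    "\<And>M. max_matching D w M \<Longrightarrow> card U \<le> 2 * card {e\<in>M. e \<subseteq> U} + 1"
proof -
  obtain e0 where e0: "e0 \<in> D" using assms by blast
  obtain u y where uy: "e0 = {u, y}" "u \<noteq> y" using card2[OF e0] by (auto simp: card_2_iff)
  define U where "U = {v. (u, v) \<in> linked}"
  have linkI: "(x, z) \<in> linked" if "{x, z} \<in> D" for x z using that by (auto simp: linked_def)
  have linkT: "(x, z) \<in> linked" if "(x, y) \<in> linked" "(y, z) \<in> linked" for x y z
    using that by (auto simp: linked_def)
  have linkS: "(z, x) \<in> linked" if "(x, z) \<in> linked" for x z
  proof -
    have "sym {(x, y). {x, y} \<in> D}" by (auto simp: sym_def insert_commute)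
    thus ?thesis using that unfolding linked_def by (metis sym_rtrancl symD)
  qed
  have uU: "u \<in> U" by (simp add: U_def linked_def)
  have yU: "y \<in> U" using linkI e0 uy by (simp add: U_def)
  have UD: "U \<subseteq> \<Union>D"
  proof
    fix v assume "v \<in> U"
    hence "(u, v) \<in> {(x, y). {x, y} \<in> D}\<^sup>*" by (simp add: U_def linked_def)
    thus "v \<in> \<Union>D" by (cases rule: rtranclE) (use e0 uy in auto)
  qed
  have closed: "e \<subseteq> U" if "e \<in> D" "v \<in> e" "v \<in> U" for e v
  proof -
    note e = that
    obtain a b where ab: "e = {a, b}" using card2[OF e(1)] by (auto simp: card_2_iff)
    have "(a, b) \<in> linked" "(b, a) \<in> linked" using linkI linkS e(1) ab by auto
    thus ?thesis using e(2,3) linkT[of u] unfolding U_def ab by blast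
  qed
  have count: "card U = 2 * card {e\<in>M. e \<subseteq> U} + card (U - \<Union>M)" if M: "max_matching D w M" for M
  proof -
    let ?N = "{e\<in>M. e \<subseteq> U}"
    have "card (\<Union>?N) = sum card ?N"
      by (rule card_Union_disjoint) (use M in \<open>auto simp: max_matching_def matching_def pairwise_def disjnt_def\<close>)
    also have "\<dots> = (\<Sum>e\<in>?N. 2)"
      by (rule sum.cong) (use M in \<open>auto simp: max_matching_def matching_def\<close>)
    finally have "card (\<Union>?N) = 2 * card ?N" by simp
    moreover have "U = \<Union>?N \<union> (U - \<Union>M)" "\<Union>?N \<inter> (U - \<Union>M) = {}"
      using closed M unfolding max_matching_def by blast+
    ultimately show ?thesis by (metis card_Un_disjoint finite)
  qed
  have le1: "card (U - \<Union>M) \<le> 1" if M: "max_matching D w M" for M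
  proof -
    have "x = y" if "x \<in> U - \<Union>M" "y \<in> U - \<Union>M" for x y
    proof (rule at_most_one_missed[OF _ M])
      show "(x, y) \<in> linked" using that linkS[of u x] linkT[of x u y] by (simp add: U_def)
    qed (use that in auto)
    hence "\<forall>x\<in>U - \<Union>M. \<forall>y\<in>U - \<Union>M. x = y" by blast
    thus ?thesis by (simp add: card_le_Suc0_iff_eq)
  qed
  obtain M0 where M0: "max_matching D w M0" "u \<notin> \<Union>M0" using missed[of u] e0 uy(1) by auto
  have "u \<in> U - \<Union>M0" using M0(2) uU by simp
  hence "card (U - \<Union>M0) \<noteq> 0" by (metis card_0_eq empty_iff finite)
  hence "card (U - \<Union>M0) = 1" using le1[OF M0(1)] by linarith
  hence odd: "odd (card U)" using count[OF M0(1)] by simp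
  have "card {u, y} \<le> card U" by (rule card_mono) (use uU yU in auto)
  hence "card U \<ge> 2" using uy by simp
  hence "card U \<ge> 3" using odd by (cases "card U = 2") auto
  thus thesis
  proof (rule that[OF UD odd])
    fix M assume M: "max_matching D w M"
    show "card U \<le> 2 * card {e\<in>M. e \<subseteq> U} + 1" using count[OF M] le1[OF M] by linarith
  qed
qed

end

section \<open>The conflict graph of the representatives constraints\<close>

locale representatives =
  fixes G :: "'v::finite graph" and r :: "('v \<times> 'v) set"
  assumes graph: "simple_graph G" and order: "strict_linear_order_on (verts G) r"
begin

abbreviation N :: "'v set set" where "N \<equiv> edges (complement G)"
abbreviation R :: "'v set graph" where "R \<equiv> rep_graph r G"

lemma N_iff: "{u, v} \<in> N \<longleftrightarrow> u \<in> verts G \<and> v \<in> verts G \<and> u \<noteq> v \<and> {u, v} \<notin> edges G"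
  by (auto simp: complement_def doubleton_eq_iff insert_commute)

lemma N_card: "e \<in> N \<Longrightarrow> card e = 2"
  by (auto simp: complement_def)

lemma N_edge:
  assumes "e \<in> N" "u \<in> e"
  obtains v where "e = {u, v}" "u \<noteq> v"
proof -
  obtain x y where "e = {x, y}" "x \<noteq> y" using N_card[OF assms(1)] by (auto simp: card_2_iff)
  thus ?thesis using assms(2) that[of x] that[of y] by (auto simp: insert_commute)
qed

lemma order_trans: "(x, y) \<in> r \<Longrightarrow> (y, z) \<in> r \<Longrightarrow> (x, z) \<in> r"
  using order unfolding strict_linear_order_on_def by (meson transD)

lemma order_asym: "(x, y) \<in> r \<Longrightarrow> (y, x) \<notin> r"
  using order order_trans unfolding strict_linear_order_on_def irrefl_def by blast

lemma order_total: "{x, y} \<in> N \<Longrightarrow> (x, y) \<in> r \<or> (y, x) \<in> r"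
  using order N_iff[of x y] unfolding strict_linear_order_on_def total_on_def by blast

lemma verts_R: "verts R = N"
  by (simp add: rep_graph_def)

lemma adjacent_iff_common: "{e, f} \<in> edges R \<longleftrightarrow> e \<in> N \<and> f \<in> N \<and> e \<noteq> f \<and>
    (\<exists>u K. rep_index r G u K \<and> e \<in> rep_variables r G u K \<and> f \<in> rep_variables r G u K)"
  unfolding rep_graph_def by (auto simp: doubleton_eq_iff)

lemma rep_variables_iff:
  "e \<in> rep_variables r G u K \<longleftrightarrow> (\<exists>v. e = {u, v} \<and> (({u, v} \<in> N \<and> (v, u) \<in> r) \<or> v \<in> K))"
  unfolding rep_variables_def lower_nonnbrs_def by (auto simp: insert_commute)

lemma rep_index_upper: "rep_index r G u K \<Longrightarrow> v \<in> K \<Longrightarrow> {u, v} \<in> N \<and> (u, v) \<in> r"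
  by (auto simp: rep_index_def upper_nonnbrs_def)

lemma rep_indexI:
  assumes "u \<in> verts G" "\<And>v. v \<in> K \<Longrightarrow> {u, v} \<in> N \<and> (u, v) \<in> r"
    "\<And>v v'. v \<in> K \<Longrightarrow> v' \<in> K \<Longrightarrow> v \<noteq> v' \<Longrightarrow> {v, v'} \<notin> N"
  shows "rep_index r G u K"
  using assms N_iff by (fastforce simp: rep_index_def is_clique_def upper_nonnbrs_def)

lemma rep_variables_clique:
  assumes "rep_index r G u K"
  shows "is_clique R (rep_variables r G u K)"
proof -
  have "rep_variables r G u K \<subseteq> N"
    using rep_index_upper[OF assms] by (auto simp: rep_variables_iff)
  thus ?thesis using assms unfolding is_clique_def verts_R adjacent_iff_common by blast
qed

lemma adjacent_share:
  assumes "{e, f} \<in> edges R"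
  shows "e \<inter> f \<noteq> {}"
  using assms by (auto simp: adjacent_iff_common rep_variables_iff)

text \<open>Two lower neighbours of \<open>u\<close>, or a lower and an upper one, always occur in a common constraint at \<open>u\<close>;
  two upper ones do if and only if they form a clique of \<open>G\<close>. So adjacency fails exactly when \<open>u\<close> is the
  least vertex of a triangle \<open>u v v'\<close> of the complement.\<close>

lemma adjacent_iff:
  assumes e: "{u, v} \<in> N" and f: "{u, v'} \<in> N" and ne: "v \<noteq> v'"
  shows "{{u, v}, {u, v'}} \<in> edges R \<longleftrightarrow> \<not> ((u, v) \<in> r \<and> (u, v') \<in> r \<and> {v, v'} \<in> N)"
proof
  assume "{{u, v}, {u, v'}} \<in> edges R"
  then obtain x K where x: "rep_index r G x K" "{u, v} \<in> rep_variables r G x K"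
    "{u, v'} \<in> rep_variables r G x K" by (auto simp: adjacent_iff_common)
  \<comment> \<open>A constraint at \<open>x\<close> only has variables at \<open>x\<close>, and two distinct pairs share one vertex only.\<close>
  have "x \<in> {u, v}" "x \<in> {u, v'}" using x(2,3) by (auto simp: rep_variables_iff)
  hence xu: "x = u" using ne by auto
  have K: "v \<in> K" if "(u, v) \<in> r" "{u, v} \<in> rep_variables r G u K" for v
    using that order_asym by (auto simp: rep_variables_iff doubleton_eq_iff)
  show "\<not> ((u, v) \<in> r \<and> (u, v') \<in> r \<and> {v, v'} \<in> N)"
  proof
    assume a: "(u, v) \<in> r \<and> (u, v') \<in> r \<and> {v, v'} \<in> N"
    hence "v \<in> K" "v' \<in> K" using K x xu by auto
    hence "{v, v'} \<in> edges G" using x(1) ne by (auto simp: rep_index_def is_clique_def)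
    thus False using a N_iff by blast
  qed
next
  assume n: "\<not> ((u, v) \<in> r \<and> (u, v') \<in> r \<and> {v, v'} \<in> N)"
  define K where "K = {z \<in> {v, v'}. (u, z) \<in> r}"
  have "rep_index r G u K"
  proof (rule rep_indexI)
    show "u \<in> verts G" using e N_iff by blast
    show "{u, z} \<in> N \<and> (u, z) \<in> r" if "z \<in> K" for z using that e f by (auto simp: K_def)
    show "{z, z'} \<notin> N" if "z \<in> K" "z' \<in> K" "z \<noteq> z'" for z z'
      using that n by (auto simp: K_def insert_commute)
  qed
  moreover have "{u, z} \<in> rep_variables r G u K" if "z \<in> {v, v'}" for z
  proof -
    have "{u, z} \<in> N" using that e f by auto
    thus ?thesis using that order_total[of u z] unfolding rep_variables_iff K_def by auto
  qed
  moreover have "{u, v} \<noteq> {u, v'}" using ne by (auto simp: doubleton_eq_iff)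
  ultimately show "{{u, v}, {u, v'}} \<in> edges R"
    using e f unfolding adjacent_iff_common by blast
qed

lemma star_clique:
  assumes S: "\<And>e. e \<in> S \<Longrightarrow> e \<in> N \<and> x \<in> e"
    and no: "\<And>d d'. {x, d} \<in> S \<Longrightarrow> {x, d'} \<in> S \<Longrightarrow> (x, d) \<in> r \<Longrightarrow> (x, d') \<in> r \<Longrightarrow> {d, d'} \<notin> N"
  shows "is_clique R S"
  unfolding is_clique_def verts_R
proof (intro conjI ballI impI)
  show "S \<subseteq> N" using S by blast
  fix e f assume e: "e \<in> S" and f: "f \<in> S" and ef: "e \<noteq> f"
  obtain d where d: "e = {x, d}" using N_edge S[OF e] by blast
  obtain d' where d': "f = {x, d'}" using N_edge S[OF f] by blast
  show "{e, f} \<in> edges R"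
    using adjacent_iff[of x d d'] no[of d d'] S[OF e] S[OF f] e f ef unfolding d d' by blast
qed

text \<open>If no edge outside \<open>C\<close> touches an edge of \<open>C\<close>, then stable sets inside and outside \<open>C\<close> can be combined
  freely, so an optimal stable set is optimal in each part.\<close>

lemma max_stable_restrict:
  assumes C: "C \<subseteq> N" and sep: "\<And>e f. e \<in> C \<Longrightarrow> f \<in> N \<Longrightarrow> e \<inter> f \<noteq> {} \<Longrightarrow> f \<in> C"
    and M: "max_stable R N w M"
  shows "max_stable R C w (M \<inter> C)"
  unfolding max_stable_def
proof (intro conjI allI impI)
  have st: "stable_set R M" and MN: "M \<subseteq> N" using M by (auto simp: max_stable_def)
  show "stable_set R (M \<inter> C)" using stable_subset[OF st] by blast
  fix S assume S: "stable_set R S \<and> S \<subseteq> C"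
  have cross: "{e, f} \<notin> edges R" "{f, e} \<notin> edges R" if "e \<in> C" "f \<in> N - C" for e f
    using that sep[of e f] adjacent_share[of e f] adjacent_share[of f e] by blast+
  have "stable_set R (S \<union> (M - C))"
    unfolding stable_set_def verts_R
  proof (intro conjI ballI impI)
    show "S \<union> (M - C) \<subseteq> N" using S C MN by blast
    fix e f assume e: "e \<in> S \<union> (M - C)" and f: "f \<in> S \<union> (M - C)" and ef: "e \<noteq> f"
    have 1: "{e, f} \<notin> edges R" if "e \<in> S" "f \<in> S"
      using S that ef by (auto simp: stable_set_def)
    have 2: "{e, f} \<notin> edges R" if "e \<in> M" "f \<in> M"
      using st that ef by (auto simp: stable_set_def)
    show "{e, f} \<notin> edges R"
      using e f 1 2 cross S MN by blast
  qed
  moreover have "S \<union> (M - C) \<subseteq> N" using S C MN by blast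
  ultimately have "sum w (S \<union> (M - C)) \<le> sum w M"
    using M unfolding max_stable_def by blast
  moreover have "sum w (S \<union> (M - C)) = sum w S + sum w (M - C)"
    by (rule sum.union_disjoint) (use S in auto)
  moreover have "sum w M = sum w (M \<inter> C) + sum w (M - C)"
    by (simp add: sum.Int_Diff)
  ultimately show "sum w S \<le> sum w (M \<inter> C)" by linarith
qed simp

definition meeting :: "'v set \<Rightarrow> 'v set set" where
  "meeting T = {e \<in> N. e \<inter> T \<noteq> {}}"

text \<open>If all edges of the component meet \<open>{a, b}\<close>, then a triangle \<open>a d d'\<close> with \<open>b\<close> not in it cannot
  exist, as its edge \<open>d d'\<close> avoids \<open>{a, b}\<close>. Hence the edges at \<open>a\<close> other than \<open>ab\<close> form a clique of \<open>R\<close>.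
  The edges at \<open>b\<close> form a clique too: a triangle at \<open>b\<close> must contain \<open>a\<close>, and \<open>b\<close> is not its least
  vertex because \<open>a\<close> precedes \<open>b\<close>.\<close>

lemma edge_star_pair_cobipartite:
  assumes ab: "{a, b} \<in> N" "(a, b) \<in> r"
    and closed: "\<And>e f. e \<in> meeting {a, b} \<Longrightarrow> f \<in> N \<Longrightarrow> e \<inter> f \<noteq> {} \<Longrightarrow> f \<in> meeting {a, b}"
    and w0: "\<forall>e\<in>N. w e \<ge> 0" and pos: "\<exists>e\<in>meeting {a, b}. w e > (0::real)"
  shows "\<exists>K. is_clique R K \<and> (\<forall>M. max_stable R (meeting {a, b}) w M \<longrightarrow> M \<inter> K \<noteq> {})"
proof (rule cobipartite_clique)
  define X where "X = {e \<in> N. a \<in> e \<and> b \<notin> e}"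
  define Y where "Y = {e \<in> N. b \<in> e}"
  show "meeting {a, b} = X \<union> Y" by (auto simp: meeting_def X_def Y_def)
  have chord: "{d, d'} \<inter> {a, b} \<noteq> {}" if "e \<in> N" "e \<inter> {a, b} \<noteq> {}" "d \<in> e" "{d, d'} \<in> N" for e d d'
    using closed[of e "{d, d'}"] that by (auto simp: meeting_def)
  show "is_clique R X"
  proof (rule star_clique[of X a])
    fix d d' assume d: "{a, d} \<in> X" "{a, d'} \<in> X"
    have "a \<noteq> d" "a \<noteq> d'" using d N_iff by (auto simp: X_def)
    thus "{d, d'} \<notin> N" using chord[of "{a, d}" d d'] d by (auto simp: X_def)
  qed (auto simp: X_def)
  show "is_clique R Y"
  proof (rule star_clique[of Y b])
    fix d d' assume d: "{b, d} \<in> Y" "{b, d'} \<in> Y" and o: "(b, d) \<in> r" "(b, d') \<in> r"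
    have "b \<noteq> d" "b \<noteq> d'" using d N_iff by (auto simp: Y_def)
    moreover have "a \<noteq> d" "a \<noteq> d'" using o ab(2) order_asym by blast+
    ultimately show "{d, d'} \<notin> N" using chord[of "{b, d}" d d'] d by (auto simp: Y_def)
  qed (auto simp: Y_def)
qed (use w0 pos in \<open>auto simp: meeting_def\<close>)

text \<open>The structure of \<open>four_cliques\<close> arises from a triangle \<open>u < v < z\<close> such that any further
  vertex \<open>d\<close> joined to two of its vertices precedes \<open>u\<close>. Then \<open>a = uv\<close> and \<open>c = uz\<close> is the pair that is
  not adjacent, and \<open>b = vz\<close>; the sets \<open>Pu\<close>, \<open>Pv\<close>, \<open>Pw\<close> collect the remaining edges at \<open>u\<close>, \<open>v\<close> and \<open>z\<close>.
  Two remaining edges from the same \<open>d\<close> are not adjacent, since \<open>d\<close> is the least vertex of the triangle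
  that they span. So the case of a complete graph on four vertices looks as if its least vertex were
  split into three pendant vertices.\<close>

lemma sorted_triangle_four_cliques:
  assumes tri: "{u, v} \<in> N" "{v, z} \<in> N" "{u, z} \<in> N" and lt: "(u, v) \<in> r" "(v, z) \<in> r"
    and closed: "\<And>e f. e \<in> meeting {u, v, z} \<Longrightarrow> f \<in> N \<Longrightarrow> e \<inter> f \<noteq> {} \<Longrightarrow> f \<in> meeting {u, v, z}"
    and two: "\<And>d x y. d \<notin> {u, v, z} \<Longrightarrow> x \<in> {u, v, z} \<Longrightarrow> y \<in> {u, v, z} \<Longrightarrow> x \<noteq> y \<Longrightarrow>
      {x, d} \<in> N \<Longrightarrow> {y, d} \<in> N \<Longrightarrow> (d, u) \<in> r"
    and w0: "\<forall>e\<in>N. w e \<ge> 0" and pos: "\<exists>e\<in>meeting {u, v, z}. w e > (0::real)"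
  shows "\<exists>K. is_clique R K \<and> (\<forall>M. max_stable R (meeting {u, v, z}) w M \<longrightarrow> M \<inter> K \<noteq> {})"
proof -
  define Pu where "Pu = {e \<in> N. u \<in> e \<and> v \<notin> e \<and> z \<notin> e}"
  define Pv where "Pv = {e \<in> N. v \<in> e \<and> u \<notin> e \<and> z \<notin> e}"
  define Pw where "Pw = {e \<in> N. z \<in> e \<and> u \<notin> e \<and> v \<notin> e}"
  have ne: "u \<noteq> v" "v \<noteq> z" "u \<noteq> z" using tri N_iff by auto
  have uz: "(u, z) \<in> r" using lt order_trans by blast
  \<comment> \<open>An edge that forms a triangle with an edge of the component is itself in the component.\<close>
  have chord: "{d, d'} \<inter> {u, v, z} \<noteq> {}"
    if "x \<in> {u, v, z}" "{x, d} \<in> N" "{d, d'} \<in> N" for x d d'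
    using closed[of "{x, d}" "{d, d'}"] that by (auto simp: meeting_def)
  have pair: "e = {x, y}" if "e \<in> N" "x \<in> e" "y \<in> e" "x \<noteq> y" for e x y
    using that by (metis N_edge insertE singletonD)
  have sub_v: "{{u, v}, {v, z}} \<union> Pv \<subseteq> N" and sub_z: "{{v, z}, {u, z}} \<union> Pw \<subseteq> N"
    using tri by (auto simp: Pv_def Pw_def)
  show ?thesis
  proof (rule four_cliques[where a = "{u, v}" and b = "{v, z}" and c = "{u, z}"
        and Pu = Pu and Pv = Pv and Pw = Pw])
    show "meeting {u, v, z} = {{u, v}, {v, z}, {u, z}} \<union> Pu \<union> Pv \<union> Pw"
    proof (intro equalityI subsetI)
      fix e assume "e \<in> meeting {u, v, z}"
      hence e: "e \<in> N" "u \<in> e \<or> v \<in> e \<or> z \<in> e" by (auto simp: meeting_def)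
      thus "e \<in> {{u, v}, {v, z}, {u, z}} \<union> Pu \<union> Pv \<union> Pw"
        using pair[OF e(1), of u v] pair[OF e(1), of v z] pair[OF e(1), of u z] ne
        by (auto simp: Pu_def Pv_def Pw_def)
    qed (use tri in \<open>auto simp: meeting_def Pu_def Pv_def Pw_def\<close>)
    show "meeting {u, v, z} \<subseteq> verts R" by (auto simp: meeting_def verts_R)
    show "{u, v} \<noteq> {v, z}" "{u, v} \<noteq> {u, z}" "{v, z} \<noteq> {u, z}" using ne by (auto simp: doubleton_eq_iff)
    show "{{u, v}, {v, z}, {u, z}} \<inter> (Pu \<union> Pv \<union> Pw) = {}" "Pu \<inter> Pv = {}" "Pu \<inter> Pw = {}" "Pv \<inter> Pw = {}"
      by (auto simp: Pu_def Pv_def Pw_def)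
    show "is_clique R (insert {u, v} Pu)"
    proof (rule star_clique[of _ u])
      fix d d' assume d: "{u, d} \<in> insert {u, v} Pu" "{u, d'} \<in> insert {u, v} Pu"
        and o: "(u, d) \<in> r" "(u, d') \<in> r"
      show "{d, d'} \<notin> N"
      proof
        assume dd: "{d, d'} \<in> N"
        have N: "{u, d} \<in> N" "{u, d'} \<in> N" "d \<noteq> u" "d' \<noteq> u" "d \<noteq> z" "d' \<noteq> z" "d \<noteq> d'"
          using d tri dd N_iff[of u d] N_iff[of u d'] N_iff[of d d'] ne by (auto simp: Pu_def doubleton_eq_iff)
        have "{d, d'} \<inter> {u, v, z} \<noteq> {}" using chord[of u d d'] N dd by blast
        hence "d = v \<or> d' = v" using N by auto
        hence "(d, u) \<in> r \<or> (d', u) \<in> r"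
          using two[of d' u v] two[of d u v] N dd ne by (auto simp: insert_commute)
        thus False using o order_asym by blast
      qed
    qed (use tri in \<open>auto simp: Pu_def\<close>)
    show "is_clique R (insert {u, z} Pu)"
    proof (rule star_clique[of _ u])
      fix d d' assume d: "{u, d} \<in> insert {u, z} Pu" "{u, d'} \<in> insert {u, z} Pu"
        and o: "(u, d) \<in> r" "(u, d') \<in> r"
      show "{d, d'} \<notin> N"
      proof
        assume dd: "{d, d'} \<in> N"
        have N: "{u, d} \<in> N" "{u, d'} \<in> N" "d \<noteq> u" "d' \<noteq> u" "d \<noteq> v" "d' \<noteq> v" "d \<noteq> d'"
          using d tri dd N_iff[of u d] N_iff[of u d'] N_iff[of d d'] ne by (auto simp: Pu_def doubleton_eq_iff)
        have "{d, d'} \<inter> {u, v, z} \<noteq> {}" using chord[of u d d'] N dd by blast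
        hence "d = z \<or> d' = z" using N by auto
        hence "(d, u) \<in> r \<or> (d', u) \<in> r"
          using two[of d' u z] two[of d u z] N dd ne by (auto simp: insert_commute)
        thus False using o order_asym by blast
      qed
    qed (use tri in \<open>auto simp: Pu_def\<close>)
    show "is_clique R ({{u, v}, {v, z}} \<union> Pv)"
    proof (rule star_clique[of _ v])
      fix d d' assume d: "{v, d} \<in> {{u, v}, {v, z}} \<union> Pv" "{v, d'} \<in> {{u, v}, {v, z}} \<union> Pv"
        and o: "(v, d) \<in> r" "(v, d') \<in> r"
      show "{d, d'} \<notin> N"
      proof
        assume dd: "{d, d'} \<in> N"
        have "{v, d} \<in> N" "{v, d'} \<in> N" using d sub_v by blast+
        hence N: "{v, d} \<in> N" "{v, d'} \<in> N" "d \<noteq> v" "d' \<noteq> v" "d \<noteq> d'"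
          using dd N_iff[of v d] N_iff[of v d'] N_iff[of d d'] by auto
        have du: "d \<noteq> u" "d' \<noteq> u" using o lt order_asym by blast+
        have "{d, d'} \<inter> {u, v, z} \<noteq> {}" using chord[of v d d'] N dd by blast
        hence "d = z \<or> d' = z" using N du by auto
        hence "(d, u) \<in> r \<or> (d', u) \<in> r"
          using two[of d' v z] two[of d v z] N dd ne du by (auto simp: insert_commute)
        thus False using o lt order_asym order_trans by blast
      qed
    qed (use tri in \<open>auto simp: Pv_def\<close>)
    show "is_clique R ({{v, z}, {u, z}} \<union> Pw)"
    proof (rule star_clique[of _ z])
      fix d d' assume d: "{z, d} \<in> {{v, z}, {u, z}} \<union> Pw" "{z, d'} \<in> {{v, z}, {u, z}} \<union> Pw"
        and o: "(z, d) \<in> r" "(z, d') \<in> r"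
      show "{d, d'} \<notin> N"
      proof
        assume dd: "{d, d'} \<in> N"
        have "{z, d} \<in> N" "{z, d'} \<in> N" using d sub_z by blast+
        hence N: "{z, d} \<in> N" "{z, d'} \<in> N" "d \<noteq> z" "d' \<noteq> z"
          using N_iff[of z d] N_iff[of z d'] by auto
        have "d \<noteq> u" "d' \<noteq> u" "d \<noteq> v" "d' \<noteq> v" using o lt uz order_asym by blast+
        moreover have "{d, d'} \<inter> {u, v, z} \<noteq> {}" using chord[of z d d'] N dd by blast
        ultimately show False using N by auto
      qed
    qed (use tri in \<open>auto simp: Pw_def\<close>)
    show "{{u, v}, {u, z}} \<notin> edges R" using adjacent_iff[of u v z] tri lt uz ne by blast
    show "\<forall>x\<in>Pw. {{u, v}, x} \<notin> edges R" using adjacent_share[of "{u, v}"] by (auto simp: Pw_def)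
    show "\<forall>x\<in>Pv. {{u, z}, x} \<notin> edges R" using adjacent_share[of "{u, z}"] by (auto simp: Pv_def)
    show "\<forall>x\<in>Pu. {{v, z}, x} \<notin> edges R" using adjacent_share[of "{v, z}"] by (auto simp: Pu_def)
    have pend: "{e, f} \<notin> edges R"
      if xy: "x \<in> {u, v, z}" "y \<in> {u, v, z}" "{x, y} \<in> N" and e: "e \<in> N" "x \<in> e" "e \<inter> {u, v, z} \<subseteq> {x}"
        and f: "f \<in> N" "y \<in> f" "f \<inter> {u, v, z} \<subseteq> {y}" for e f x y
    proof
      assume adj: "{e, f} \<in> edges R"
      obtain d where d: "e = {x, d}" "x \<noteq> d" using N_edge[OF e(1,2)] .
      obtain d' where d': "f = {y, d'}" "y \<noteq> d'" using N_edge[OF f(1,2)] .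
      have "x \<noteq> y" using xy(3) N_iff by blast
      have d_out: "d \<notin> {u, v, z}" using d e(3) by blast
      have "d' \<notin> {u, v, z}" using d' f(3) by blast
      hence dd: "d' = d" "d \<notin> {u, v, z}"
        using adjacent_share[OF adj] d_out xy(1,2) \<open>x \<noteq> y\<close> unfolding d d' by blast+
      have du: "(d, u) \<in> r" using two[of d x y] dd d d' e(1) f(1) xy \<open>x \<noteq> y\<close> by blast
      hence "(d, x) \<in> r" "(d, y) \<in> r" using xy lt uz order_trans by blast+
      thus False using adjacent_iff[of d x y] adj e(1) f(1) xy(3) \<open>x \<noteq> y\<close> unfolding d d' dd
        by (simp add: insert_commute)
    qed
    show "\<forall>x\<in>Pu. \<forall>y\<in>Pv. {x, y} \<notin> edges R"
      using pend[of u v] tri by (auto simp: Pu_def Pv_def)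
    show "\<forall>x\<in>Pu. \<forall>y\<in>Pw. {x, y} \<notin> edges R"
      using pend[of u z] tri by (auto simp: Pu_def Pw_def)
    show "\<forall>x\<in>Pv. \<forall>y\<in>Pw. {x, y} \<notin> edges R"
      using pend[of v z] tri by (auto simp: Pv_def Pw_def)
    show "\<forall>e\<in>meeting {u, v, z}. 0 \<le> w e" using w0 by (auto simp: meeting_def)
  qed (rule pos)
qed

end

section \<open>Triangles in kite-free graphs\<close>

locale kite_free = representatives G r
  for G :: "'v::finite graph" and r :: "('v \<times> 'v) set" +
  assumes no_kite: "\<not> has_subgraph (complement G) kite"
begin

lemma pendant_path_blocked:
  assumes "{a, b} \<in> N" "{b, c} \<in> N" "{a, c} \<in> N" "{a, x} \<in> N" "{x, y} \<in> N"
    and "x \<notin> {a, b, c}"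
  shows "y \<in> {a, b, c}"
proof (rule ccontr)
  assume y: "y \<notin> {a, b, c}"
  define f where "f = (\<lambda>n::nat. if n = 0 then b else if n = 1 then c else if n = 2 then a else if n = 3 then x else y)"
  have d: "a \<noteq> b" "b \<noteq> c" "a \<noteq> c" "x \<noteq> y" using assms N_iff by blast+
  have "inj_on f (verts kite)"
    using d assms(6) y by (auto simp: kite_def paw_def f_def inj_on_def)
  moreover have "f ` verts kite \<subseteq> verts (complement G)"
    using assms N_iff by (auto simp: kite_def paw_def f_def complement_def)
  moreover have "\<forall>e\<in>edges kite. f ` e \<in> N"
    using assms by (auto simp: kite_def paw_def f_def insert_commute)
  ultimately show False using no_kite unfolding has_subgraph_def by blast
qed

definition is_triangle :: "'v \<Rightarrow> 'v \<Rightarrow> 'v \<Rightarrow> bool" where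
  "is_triangle a b c \<longleftrightarrow> {a, b} \<in> N \<and> {b, c} \<in> N \<and> {a, c} \<in> N"

lemma triangle_rotate: "is_triangle a b c \<Longrightarrow> is_triangle b c a"
  and triangle_swap: "is_triangle a b c \<Longrightarrow> is_triangle b a c"
  by (auto simp: is_triangle_def insert_commute)

lemma triangle_distinct: "is_triangle a b c \<Longrightarrow> a \<noteq> b \<and> b \<noteq> c \<and> a \<noteq> c"
  unfolding is_triangle_def using N_iff by blast

text \<open>An edge \<open>xy\<close> away from the triangle whose end \<open>x\<close> is joined to the triangle would give a kite. So
  the edges meeting a triangle are separated from all other edges.\<close>

lemma meeting_triangle_closed:
  assumes t: "is_triangle a b c" and e: "e \<in> meeting {a, b, c}" and f: "f \<in> N" and ef: "e \<inter> f \<noteq> {}"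
  shows "f \<in> meeting {a, b, c}"
proof (rule ccontr)
  assume "\<not> ?thesis"
  hence out: "f \<inter> {a, b, c} = {}" using f by (auto simp: meeting_def)
  obtain x where x: "x \<in> e" "x \<in> f" using ef by blast
  obtain y where y: "f = {x, y}" "x \<noteq> y" using N_edge[OF f x(2)] .
  have xo: "x \<notin> {a, b, c}" and yo: "y \<notin> {a, b, c}" using out y by auto
  have eN: "e \<in> N" using e by (simp add: meeting_def)
  obtain s where s: "s \<in> e" "s \<in> {a, b, c}" using e by (auto simp: meeting_def)
  have "e = {s, x}" using N_edge[OF eN s(1)] s x(1) xo by (metis insertE singletonD)
  hence sx: "{s, x} \<in> N" using eN by simp
  obtain s2 s3 where s23: "is_triangle s s2 s3" "{s, s2, s3} = {a, b, c}"
    using s(2) t triangle_rotate by (metis insertE insert_commute singletonD)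
  have "y \<in> {s, s2, s3}"
    using pendant_path_blocked[of s s2 s3 x y] s23 sx f y(1) xo by (auto simp: is_triangle_def)
  thus False using yo s23 by simp
qed

text \<open>An edge in the component that avoids \<open>a\<close> and \<open>b\<close> must meet both triangles, hence be the edge \<open>cd\<close>.\<close>

lemma two_pages_meet_spine:
  assumes t: "is_triangle a b c" and t': "is_triangle a b d" and cd: "c \<noteq> d" "{c, d} \<notin> N"
  shows "meeting {a, b, c} = meeting {a, b}"
proof
  show "meeting {a, b, c} \<subseteq> meeting {a, b}"
  proof
    fix e assume e: "e \<in> meeting {a, b, c}"
    hence eN: "e \<in> N" by (simp add: meeting_def)
    show "e \<in> meeting {a, b}"
    proof (rule ccontr)
      assume "\<not> ?thesis"
      hence ab: "a \<notin> e" "b \<notin> e" using eN by (auto simp: meeting_def)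
      hence ce: "c \<in> e" using e by (auto simp: meeting_def)
      have ac: "{a, c} \<in> N" using t by (simp add: is_triangle_def)
      hence "{a, c} \<in> meeting {a, b, d}" by (simp add: meeting_def)
      hence "e \<in> meeting {a, b, d}"
        by (rule meeting_triangle_closed[OF t' _ eN]) (use ce in blast)
      hence de: "d \<in> e" using ab by (auto simp: meeting_def)
      obtain y where "e = {c, y}" using N_edge[OF eN ce] .
      hence "e = {c, d}" using de cd by auto
      thus False using cd eN by simp
    qed
  qed
qed (auto simp: meeting_def)

lemma triangle_third_vertex:
  assumes t: "is_triangle a b c" and s: "s \<in> {a, b, c}" "s' \<in> {a, b, c}" "s \<noteq> s'"
  shows "\<exists>p. {s, s', p} = {a, b, c} \<and> is_triangle s s' p"
proof -
  have p: "is_triangle a b c" "is_triangle a c b" "is_triangle b a c" "is_triangle b c a"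
    "is_triangle c a b" "is_triangle c b a"
    using t by (auto simp: is_triangle_def insert_commute)
  have i: "{a, c, b} = {a, b, c}" "{b, a, c} = {a, b, c}" "{b, c, a} = {a, b, c}"
    "{c, a, b} = {a, b, c}" "{c, b, a} = {a, b, c}" by auto
  consider "s = a" "s' = b" | "s = a" "s' = c" | "s = b" "s' = a" | "s = b" "s' = c"
    | "s = c" "s' = a" | "s = c" "s' = b" using s by auto
  thus ?thesis using p i by cases metis+
qed

text \<open>The case distinction of the first half of the proof: a vertex \<open>d\<close> joined to two vertices of the
  triangle either gives two triangles on a common edge with non-adjacent tips, or completes the triangle
  to a complete graph on four vertices. In the latter case, the four-clique structure comes from the
  triangle of the three greatest vertices, since the fourth then precedes all of them.\<close>

lemma triangle_clique:
  assumes t: "is_triangle a b c" and w0: "\<forall>e\<in>N. w e \<ge> 0" and pos: "\<exists>e\<in>meeting {a, b, c}. w e > (0::real)"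
  shows "\<exists>K. is_clique R K \<and> (\<forall>M. max_stable R N w M \<longrightarrow> M \<inter> K \<noteq> {})"
proof -
  have lift: ?thesis if ex: "\<exists>K. is_clique R K \<and> (\<forall>M. max_stable R (meeting {x, y, z}) w M \<longrightarrow> M \<inter> K \<noteq> {})"
    and tri: "is_triangle x y z" for x y z
  proof -
    obtain K where K: "is_clique R K" "\<forall>M. max_stable R (meeting {x, y, z}) w M \<longrightarrow> M \<inter> K \<noteq> {}"
      using ex by blast
    have "M \<inter> K \<noteq> {}" if M: "max_stable R N w M" for M
    proof -
      have "max_stable R (meeting {x, y, z}) w (M \<inter> meeting {x, y, z})"
      proof (rule max_stable_restrict[OF _ _ M])
        show "meeting {x, y, z} \<subseteq> N" by (auto simp: meeting_def)
      qed (rule meeting_triangle_closed[OF tri])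
      thus ?thesis using K(2) by blast
    qed
    thus ?thesis using K(1) by blast
  qed
  have spine: ?thesis if xy: "is_triangle x y p" "is_triangle x y q" "p \<noteq> q" "{p, q} \<notin> N" "{x, y, p} = {a, b, c}" "(x, y) \<in> r"
    for x y p q
  proof (rule lift[OF _ xy(1)])
    have eq: "meeting {x, y, p} = meeting {x, y}" using two_pages_meet_spine xy by blast
    show "\<exists>K. is_clique R K \<and> (\<forall>M. max_stable R (meeting {x, y, p}) w M \<longrightarrow> M \<inter> K \<noteq> {})"
      unfolding eq
    proof (rule edge_star_pair_cobipartite[OF _ xy(6) _ w0])
      show "{x, y} \<in> N" using xy(1) by (simp add: is_triangle_def)
      show "\<exists>e\<in>meeting {x, y}. 0 < w e" using pos eq xy(5) by simp
      show "f \<in> meeting {x, y}" if "e \<in> meeting {x, y}" "f \<in> N" "e \<inter> f \<noteq> {}" for e f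
        using meeting_triangle_closed[OF xy(1), of e f] that eq by simp
    qed
  qed
  have four: ?thesis if xy: "is_triangle x y z" "(x, y) \<in> r" "(y, z) \<in> r" "\<exists>e\<in>meeting {x, y, z}. w e > 0"
    "\<And>d s s'. d \<notin> {x, y, z} \<Longrightarrow> s \<in> {x, y, z} \<Longrightarrow> s' \<in> {x, y, z} \<Longrightarrow> s \<noteq> s' \<Longrightarrow>
      {s, d} \<in> N \<Longrightarrow> {s', d} \<in> N \<Longrightarrow> (d, x) \<in> r" for x y z
  proof (rule lift[OF _ xy(1)])
    show "\<exists>K. is_clique R K \<and> (\<forall>M. max_stable R (meeting {x, y, z}) w M \<longrightarrow> M \<inter> K \<noteq> {})"
    proof (rule sorted_triangle_four_cliques[OF _ _ _ xy(2,3) _ _ w0 xy(4)])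
      show "(d, x) \<in> r" if "d \<notin> {x, y, z}" "s \<in> {x, y, z}" "s' \<in> {x, y, z}" "s \<noteq> s'"
        "{s, d} \<in> N" "{s', d} \<in> N" for d s s'
        by (rule xy(5)[OF that])
      show "f \<in> meeting {x, y, z}" if "e \<in> meeting {x, y, z}" "f \<in> N" "e \<inter> f \<noteq> {}" for e f
        using meeting_triangle_closed[OF xy(1)] that by blast
    qed (use xy(1) in \<open>auto simp: is_triangle_def\<close>)
  qed
  have sorted: "\<exists>x y z. is_triangle x y z \<and> (x, y) \<in> r \<and> (y, z) \<in> r \<and> {x, y, z} = {p, q, s}"
    if pqs: "is_triangle p q s" for p q s
  proof -
    have o: "(p, q) \<in> r \<or> (q, p) \<in> r" "(q, s) \<in> r \<or> (s, q) \<in> r" "(p, s) \<in> r \<or> (s, p) \<in> r"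
      using order_total pqs by (auto simp: is_triangle_def)
    have p: "is_triangle p q s" "is_triangle p s q" "is_triangle q p s" "is_triangle q s p" "is_triangle s p q" "is_triangle s q p"
      using pqs by (auto simp: is_triangle_def insert_commute)
    have i: "{p, s, q} = {p, q, s}" "{q, p, s} = {p, q, s}" "{q, s, p} = {p, q, s}"
      "{s, p, q} = {p, q, s}" "{s, q, p} = {p, q, s}" by auto
    show ?thesis using o p i by metis
  qed
  show ?thesis
  proof (cases "\<exists>d s s'. d \<notin> {a, b, c} \<and> s \<in> {a, b, c} \<and> s' \<in> {a, b, c} \<and> s \<noteq> s' \<and> {s, d} \<in> N \<and> {s', d} \<in> N")
    case no_common: False
    obtain x y z where x: "is_triangle x y z" "(x, y) \<in> r" "(y, z) \<in> r" "{x, y, z} = {a, b, c}"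
      using sorted[OF t] by blast
    show ?thesis
    proof (rule four[OF x(1-3)])
      show "\<exists>e\<in>meeting {x, y, z}. 0 < w e" using pos unfolding x(4) .
      fix d s s' assume "d \<notin> {x, y, z}" "s \<in> {x, y, z}" "s' \<in> {x, y, z}" "s \<noteq> s'"
        "{s, d} \<in> N" "{s', d} \<in> N"
      hence "d \<notin> {a, b, c}" "s \<in> {a, b, c}" "s' \<in> {a, b, c}" "s \<noteq> s'" "{s, d} \<in> N" "{s', d} \<in> N"
        unfolding x(4) by simp_all
      hence False using no_common by metis
      thus "(d, x) \<in> r" ..
    qed
  next
    case True
    then obtain d s s' where d: "d \<notin> {a, b, c}" "s \<in> {a, b, c}" "s' \<in> {a, b, c}" "s \<noteq> s'" "{s, d} \<in> N" "{s', d} \<in> N"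
      by blast
    obtain p where p: "{s, s', p} = {a, b, c}" "is_triangle s s' p"
    proof -
      have "\<exists>p. {s, s', p} = {a, b, c} \<and> is_triangle s s' p"
        using triangle_third_vertex[OF t d(2-4)] .
      thus ?thesis using that by blast
    qed
    have ssd: "is_triangle s s' d" using p(2) d by (auto simp: is_triangle_def)
    have pd: "p \<noteq> d" using p(1) d(1) by auto
    show ?thesis
    proof (cases "{p, d} \<in> N")
      case False
      have "{s, s'} \<in> N" using p(2) by (simp add: is_triangle_def)
      thus ?thesis
      proof (rule order_total[THEN disjE])
        assume "(s, s') \<in> r"
        thus ?thesis using spine[OF p(2) ssd pd False p(1)] by blast
      next
        assume "(s', s) \<in> r"
        moreover have "{s', s, p} = {a, b, c}" using p(1) by auto
        ultimately show ?thesis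
          using spine[OF triangle_swap[OF p(2)] triangle_swap[OF ssd] pd False] by blast
      qed
    next
      case True
      \<comment> \<open>A complete graph on \<open>Q\<close>; its least vertex \<open>m\<close> is left out.\<close>
      define Q where "Q = {s, s', p, d}"
      have Q: "{x, y} \<in> N" if "x \<in> Q" "y \<in> Q" "x \<noteq> y" for x y
        using that p(2) ssd True unfolding Q_def is_triangle_def
        by (elim insertE emptyE) (auto simp: insert_commute)
      have cardQ: "card Q = 4"
        using triangle_distinct[OF p(2)] triangle_distinct[OF ssd] pd by (simp add: Q_def)
      obtain m where m: "m \<in> Q" "\<And>x. x \<in> Q \<Longrightarrow> x \<noteq> m \<Longrightarrow> (m, x) \<in> r"
      proof -
        have "\<exists>m\<in>A. \<forall>x\<in>A. x \<noteq> m \<longrightarrow> (m, x) \<in> r" if "A \<noteq> {}" "A \<subseteq> Q" for A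
          using finite[of A] that
        proof (induction rule: finite_ne_induct)
          case (insert x F)
          then obtain m where m: "m \<in> F" "\<forall>y\<in>F. y \<noteq> m \<longrightarrow> (m, y) \<in> r" by auto
          have "{x, m} \<in> N" using Q insert m(1) by auto
          hence "(x, m) \<in> r \<or> (m, x) \<in> r" by (rule order_total)
          thus ?case
          proof
            assume xm: "(x, m) \<in> r"
            have "\<forall>y\<in>insert x F. y \<noteq> x \<longrightarrow> (x, y) \<in> r"
              using xm m order_trans by (metis insertE)
            thus ?thesis by blast
          next
            assume "(m, x) \<in> r"
            thus ?thesis using m by blast
          qed
        qed simp
        from this[of Q] show ?thesis using that by (auto simp: Q_def)
      qed
      have "card (Q - {m}) = 3" using cardQ m(1) by simp
      then obtain x1 y1 z1 where Qm: "Q - {m} = {x1, y1, z1}" and ne: "x1 \<noteq> y1" "y1 \<noteq> z1" "x1 \<noteq> z1"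
        by (auto simp: card_3_iff)
      have sub: "{x1, y1, z1} \<subseteq> Q" using Qm by blast
      have "is_triangle x1 y1 z1" using Q sub ne by (simp add: is_triangle_def)
      then obtain x y z where x: "is_triangle x y z" "(x, y) \<in> r" "(y, z) \<in> r" "{x, y, z} = {x1, y1, z1}"
        using sorted by blast
      have Qx: "Q - {m} = {x, y, z}" "x \<in> Q" "y \<in> Q" "z \<in> Q" "x \<noteq> m" using Qm x(4) by auto
      have sub_meet: "e \<in> meeting {x, y, z}" if e: "e \<in> N" "e \<inter> Q \<noteq> {}" for e
      proof (cases "m \<in> e")
        case True
        have "{m, x} \<in> meeting {x, y, z}" using Q[of m x] m(1) Qx by (auto simp: meeting_def)
        thus ?thesis by (rule meeting_triangle_closed[OF x(1) _ e(1)]) (use True in blast)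
      next
        case False
        then obtain q where "q \<in> e" "q \<in> Q - {m}" using e(2) by blast
        thus ?thesis using e(1) Qx(1) unfolding meeting_def by blast
      qed
      show ?thesis
      proof (rule four[OF x(1-3)])
        have "{a, b, c} \<subseteq> Q" using p(1) by (auto simp: Q_def)
        hence "e \<in> N \<and> e \<inter> Q \<noteq> {}" if "e \<in> meeting {a, b, c}" for e
          using that unfolding meeting_def by blast
        hence "meeting {a, b, c} \<subseteq> meeting {x, y, z}" using sub_meet by blast
        thus "\<exists>e\<in>meeting {x, y, z}. 0 < w e" using pos by blast
      next
        fix g k k' assume g: "g \<notin> {x, y, z}" "k \<in> {x, y, z}" "k' \<in> {x, y, z}" "k \<noteq> k'"
          "{k, g} \<in> N" "{k', g} \<in> N"
        show "(g, x) \<in> r"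
        proof (cases "g = m")
          case True
          thus ?thesis using m(2) Qx by blast
        next
          case False
          \<comment> \<open>Edges from \<open>g\<close> to the complete graph must meet all its triangles, and \<open>kg\<close> avoids the one
            without \<open>k\<close>.\<close>
          have gQ: "g \<notin> Q" using g(1) False Qx(1) by blast
          obtain h where h: "h \<in> {x, y, z}" "h \<noteq> k" using triangle_distinct[OF x(1)] by blast
          obtain h' where h': "h' \<in> {x, y, z}" "h' \<noteq> k" "h' \<noteq> h" 
            using triangle_distinct[OF x(1)] g(2) h by auto
          have kQ: "k \<in> Q" "h \<in> Q" "h' \<in> Q" "k \<noteq> m" "h \<noteq> m" "h' \<noteq> m"
            using g(2) h h' Qx by blast+
          have tm: "is_triangle h h' m" using Q kQ h' m(1) by (auto simp: is_triangle_def)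
          have "{k, h} \<in> meeting {h, h', m}" using Q[of k h] kQ h by (auto simp: meeting_def)
          hence "{k, g} \<in> meeting {h, h', m}"
            by (rule meeting_triangle_closed[OF tm _ g(5)]) blast
          hence False using g(1) gQ h h' kQ m(1) by (auto simp: meeting_def)
          thus ?thesis ..
        qed
      qed
    qed
  qed
qed

section \<open>A tight inequality for every objective\<close>

text \<open>The edges of positive weight touch no triangle, so around them \<open>R\<close> is an ordinary line graph, and
  optimal stable sets restrict to maximum weight matchings of the positive edges.\<close>

lemma matching_tight_family:
  assumes w0: "\<forall>e\<in>N. w e \<ge> 0" and pos: "\<exists>e\<in>N. w e > (0::real)"
    and no_tri: "\<And>a b c e. is_triangle a b c \<Longrightarrow> e \<in> meeting {a, b, c} \<Longrightarrow> w e = 0"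
  shows "(\<exists>K. is_clique R K \<and> (\<forall>M. max_stable R N w M \<longrightarrow> M \<inter> K \<noteq> {})) \<or>
    (\<exists>F. (\<forall>K\<in>F. is_clique R K) \<and> 2 \<le> card F \<and>
      (\<forall>M. max_stable R N w M \<longrightarrow> cf_value R F 2 (incidence M) = cf_bound F 2))"
proof -
  define D where "D = {e\<in>N. w e > 0}"
  define star where "star x = {e\<in>N. x \<in> e}" for x
  have free: "{a, b} \<notin> N \<or> {b, c} \<notin> N \<or> {a, c} \<notin> N" if "e \<in> D" "a \<in> e" for a b c e
    using no_tri[of a b c e] that unfolding D_def is_triangle_def meeting_def by force
  have star: "is_clique R (star x)" if "x \<in> \<Union>D" for x
  proof (rule star_clique)
    fix d d' assume "{x, d} \<in> star x" "{x, d'} \<in> star x"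
    thus "{d, d'} \<notin> N" using free[of _ x d d'] that unfolding star_def by blast
  qed (simp add: star_def)
  have disj: "e \<inter> f = {}" if S: "stable_set R S" and ef: "e \<in> S" "f \<in> S" "e \<noteq> f" "e \<in> D" "f \<in> D" for S e f
  proof (rule ccontr)
    assume "e \<inter> f \<noteq> {}"
    then obtain x where x: "x \<in> e" "x \<in> f" by blast
    have "x \<in> \<Union>D" using x(1) ef(4) by blast
    hence "is_clique R (star x)" by (rule star)
    moreover have "e \<in> star x" "f \<in> star x" using x ef(4,5) by (auto simp: star_def D_def)
    ultimately show False using stable_clique_unique[OF S, of "star x" e f] ef by blast
  qed
  have match: "matching (S \<inter> D)" if "stable_set R S" for S
    unfolding matching_def using disj[OF that] N_card by (auto simp: D_def)
  have stable: "stable_set R S" if "matching S" "S \<subseteq> D" for S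
    unfolding stable_set_def verts_R
  proof (intro conjI ballI impI)
    show "S \<subseteq> N" using that by (auto simp: D_def)
    fix e f assume "e \<in> S" "f \<in> S" "e \<noteq> f"
    hence "e \<inter> f = {}" using that(1) by (auto simp: matching_def)
    thus "{e, f} \<notin> edges R" using adjacent_share by blast
  qed
  have maxm: "max_matching D w (M \<inter> D)" if M: "max_stable R N w M" for M
    unfolding max_matching_def
  proof (intro conjI allI impI)
    show "matching (M \<inter> D)" using match M by (simp add: max_stable_def)
    fix M' assume M': "matching M' \<and> M' \<subseteq> D"
    have "M' \<subseteq> N" using M' by (auto simp: D_def)
    hence "sum w M' \<le> sum w M" using M stable M' unfolding max_stable_def by blast
    also have "\<dots> = sum w (M \<inter> D)"
    proof (rule sum.mono_neutral_right)
      show "\<forall>e\<in>M - M \<inter> D. w e = 0" using M w0 by (force simp: max_stable_def D_def)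
    qed auto
    finally show "sum w M' \<le> sum w (M \<inter> D)" .
  qed simp
  show ?thesis
  proof (cases "\<exists>x\<in>\<Union>D. \<forall>M. max_stable R N w M \<longrightarrow> M \<inter> star x \<noteq> {}")
    case True
    thus ?thesis using star by blast
  next
    case False
    interpret missable D w
    proof
      show "card e = 2" "w e > 0" if "e \<in> D" for e using that N_card by (auto simp: D_def)
      fix x assume "x \<in> \<Union>D"
      then obtain M where M: "max_stable R N w M" "M \<inter> star x = {}" using False by blast
      have "x \<notin> \<Union>(M \<inter> D)" using M(2) by (auto simp: star_def D_def)
      thus "\<exists>M. max_matching D w M \<and> x \<notin> \<Union>M" using maxm[OF M(1)] by blast
    qed
    have "D \<noteq> {}" using pos by (auto simp: D_def)
    then obtain U where U: "U \<subseteq> \<Union>D" "odd (card U)" "card U \<ge> 3"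
      "\<And>M. max_matching D w M \<Longrightarrow> card U \<le> 2 * card {e\<in>M. e \<subseteq> U} + 1"
      using odd_component by blast
    \<comment> \<open>Clique families are sets, so distinct vertices of \<open>U\<close> must have distinct stars. Equal stars belong
      to an isolated edge \<open>uv\<close>, and an optimal matching missing \<open>u\<close> could be enlarged by it.\<close>
    have inj: "inj_on star U"
    proof (rule inj_onI, rule ccontr)
      fix u v assume uv: "u \<in> U" "v \<in> U" "star u = star v" "u \<noteq> v"
      obtain e where e: "e \<in> D" "u \<in> e" using uv(1) U(1) by blast
      have "e \<in> star v" using e uv(3) by (auto simp: star_def D_def)
      hence ve: "v \<in> e" by (simp add: star_def)
      have eN: "e \<in> N" using e by (simp add: D_def)
      have euv: "e = {u, v}" using N_edge[OF eN e(2)] ve uv(4) by (metis insertE singletonD)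
      obtain M where M: "max_matching D w M" "u \<notin> \<Union>M" using missed[of u] e by blast
      have "v \<notin> \<Union>M"
      proof
        assume "v \<in> \<Union>M"
        then obtain f where f: "f \<in> M" "v \<in> f" by blast
        have "f \<in> star v" using f M(1) by (auto simp: star_def D_def max_matching_def)
        hence "u \<in> f" using uv(3) by (auto simp: star_def)
        thus False using f M(2) by blast
      qed
      thus False using free_edge[OF M(1), of u v] e(1) euv M(2) by simp
    qed
    define F where "F = star ` U"
    have cardF: "card F = card U" unfolding F_def using inj by (rule card_image)
    have cl: "\<forall>K\<in>F. is_clique R K" using star U(1) unfolding F_def by blast
    have t2: "card U mod 2 = 1" using U(2) by (simp add: odd_iff_mod_2_eq_one)
    \<comment> \<open>For odd \<open>t = |U|\<close> and \<open>p = 2\<close> the coefficient of \<open>V_{p-1}\<close> vanishes, and \<open>V_{\<ge>p}\<close> contains the edges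
      inside \<open>U\<close>.\<close>
    have tight: "cf_value R F 2 (incidence M) = cf_bound F 2" if M: "max_stable R N w M" for M
    proof (rule antisym)
      show "cf_value R F 2 (incidence M) \<le> cf_bound F 2"
        using clique_family_valid[OF _ cl, of M 2] M by (simp add: max_stable_def)
      have sub: "{e\<in>M \<inter> D. e \<subseteq> U} \<subseteq> covered_at_least R F 2 \<inter> M"
      proof
        fix e assume e: "e \<in> {e\<in>M \<inter> D. e \<subseteq> U}"
        hence eN: "e \<in> N" by (simp add: D_def)
        obtain x y where xy: "e = {x, y}" "x \<noteq> y" using N_card[OF eN] by (auto simp: card_2_iff)
        have xyU: "x \<in> U" "y \<in> U" using e xy by auto
        have "card {star x, star y} = 2" using inj_onD[OF inj _ xyU] xy(2) by (auto simp: card_2_iff)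
        moreover have "card {star x, star y} \<le> card {K\<in>F. e \<in> K}"
          by (rule card_mono) (use xyU xy(1) eN in \<open>auto simp: F_def star_def\<close>)
        ultimately show "e \<in> covered_at_least R F 2 \<inter> M"
          using e eN by (simp add: covered_at_least_def verts_R)
      qed
      have "card U \<le> 2 * card {e\<in>M \<inter> D. e \<subseteq> U} + 1" using U(4)[OF maxm[OF M]] .
      also have "\<dots> \<le> 2 * card (covered_at_least R F 2 \<inter> M) + 1"
        using card_mono[OF _ sub] by simp
      finally have "card U div 2 \<le> card (covered_at_least R F 2 \<inter> M)" by linarith
      thus "cf_bound F 2 \<le> cf_value R F 2 (incidence M)"
        by (simp add: cf_value_def cf_bound_def cardF t2 sum_incidence)
    qed
    have "2 \<le> card F" using U(3) cardF by simp
    thus ?thesis using cl tight by blast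
  qed
qed

text \<open>The objective \<open>w\<close> has a tight inequality in the list: the non-negativity of an edge of negative
  weight, a clique inequality, or the inequality of an odd component.\<close>

lemma tight_inequality:
  fixes w :: "'v set \<Rightarrow> real"
  assumes "\<exists>e\<in>N. w e \<noteq> 0"
  shows "(\<exists>e\<in>N. \<forall>M. max_stable R N w M \<longrightarrow> e \<notin> M) \<or>
    (\<exists>F p. (\<forall>K\<in>F. is_clique R K) \<and> 1 \<le> p \<and> p \<le> card F \<and>
      (\<forall>M. max_stable R N w M \<longrightarrow> cf_value R F p (incidence M) = cf_bound F p))"
proof (cases "\<exists>e\<in>N. w e < 0")
  case True
  then obtain e where e: "e \<in> N" "w e < 0" by blast
  have "e \<notin> M" if M: "max_stable R N w M" for M
  proof
    assume eM: "e \<in> M"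
    have "stable_set R M" "M \<subseteq> N" using M by (auto simp: max_stable_def)
    hence "stable_set R (M - {e})" "M - {e} \<subseteq> N" using stable_subset[of R M "M - {e}"] by auto
    hence "sum w (M - {e}) \<le> sum w M" using M by (simp add: max_stable_def)
    thus False using e(2) eM by (simp add: sum_diff1)
  qed
  thus ?thesis using e by blast
next
  case False
  hence w0: "\<forall>e\<in>N. w e \<ge> 0" by force
  hence pos: "\<exists>e\<in>N. w e > 0" using assms by force
  have single: ?thesis if K: "is_clique R K" "\<forall>M. max_stable R N w M \<longrightarrow> M \<inter> K \<noteq> {}" for K
  proof -
    have "cf_value R {K} 1 (incidence M) = cf_bound {K} 1" if "max_stable R N w M" for M
      using cf_single[OF K(1)] K(2) that by (simp add: max_stable_def)
    thus ?thesis using K(1) by (intro disjI2 exI[of _ "{K}"] exI[of _ 1]) auto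
  qed
  show ?thesis
  proof (cases "\<exists>a b c. is_triangle a b c \<and> (\<exists>e\<in>meeting {a, b, c}. w e > 0)")
    case True
    then obtain a b c where t: "is_triangle a b c" "\<exists>e\<in>meeting {a, b, c}. w e > 0" by blast
    show ?thesis using triangle_clique[OF t(1) w0 t(2)] single by blast
  next
    case False
    have "w e = 0" if "is_triangle a b c" "e \<in> meeting {a, b, c}" for a b c e
    proof -
      have "\<not> w e > 0" using False that by blast
      moreover have "e \<in> N" using that(2) by (simp add: meeting_def)
      ultimately show ?thesis using w0 by force
    qed
    from matching_tight_family[OF w0 pos this] show ?thesis
    proof
      assume "\<exists>K. is_clique R K \<and> (\<forall>M. max_stable R N w M \<longrightarrow> M \<inter> K \<noteq> {})"
      thus ?thesis using single by blast
    next
      assume "\<exists>F. (\<forall>K\<in>F. is_clique R K) \<and> 2 \<le> card F \<and>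
        (\<forall>M. max_stable R N w M \<longrightarrow> cf_value R F 2 (incidence M) = cf_bound F 2)"
      then obtain F where F: "\<forall>K\<in>F. is_clique R K" "2 \<le> card F"
        "\<forall>M. max_stable R N w M \<longrightarrow> cf_value R F 2 (incidence M) = cf_bound F 2" by blast
      show ?thesis by (intro disjI2 exI[of _ F] exI[of _ 2]) (use F in auto)
    qed
  qed
qed

end

section \<open>The coloring polytope\<close>

context representatives
begin

lemma rep_constraint_iff:
  assumes "rep_index r G u K"
  shows "rep_constraint r G u K x \<longleftrightarrow> (\<Sum>e\<in>rep_variables r G u K. x $ e) \<le> 1"
proof -
  have i1: "inj_on (\<lambda>v. {v, u}) (lower_nonnbrs r G u)" and i2: "inj_on (\<lambda>v. {u, v}) K"
    by (auto simp: inj_on_def doubleton_eq_iff)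
  have "(\<lambda>v. {v, u}) ` lower_nonnbrs r G u \<inter> (\<lambda>v. {u, v}) ` K = {}"
    using rep_index_upper[OF assms] order_asym
    by (auto simp: lower_nonnbrs_def doubleton_eq_iff)
  hence "(\<Sum>e\<in>rep_variables r G u K. x $ e) = (\<Sum>v\<in>lower_nonnbrs r G u. x $ {v, u}) + (\<Sum>v\<in>K. x $ {u, v})"
    unfolding rep_variables_def by (subst sum.union_disjoint) (auto simp: sum.reindex i1 i2)
  thus ?thesis by (simp add: rep_constraint_def)
qed

lemma integer_points:
  "{x \<in> nonedge_space G. (\<forall>e\<in>N. x $ e \<in> {0, 1}) \<and> (\<forall>u K. rep_index r G u K \<longrightarrow> rep_constraint r G u K x)}
    = incidence ` {M. stable_set R M}"
proof (intro equalityI subsetI)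
  fix x assume "x \<in> {x \<in> nonedge_space G. (\<forall>e\<in>N. x $ e \<in> {0, 1}) \<and>
    (\<forall>u K. rep_index r G u K \<longrightarrow> rep_constraint r G u K x)}"
  hence x0: "\<And>e. e \<notin> N \<Longrightarrow> x $ e = 0" and x1: "\<And>e. e \<in> N \<Longrightarrow> x $ e = 0 \<or> x $ e = 1"
    and xc: "\<And>u K. rep_index r G u K \<Longrightarrow> (\<Sum>e\<in>rep_variables r G u K. x $ e) \<le> 1"
    using rep_constraint_iff by (auto simp: nonedge_space_def)
  define M where "M = {e. x $ e = 1}"
  have xM: "x = incidence M"
    using x0 x1 by (auto simp: vec_eq_iff incidence_def M_def)
  have "stable_set R M"
    unfolding stable_set_def verts_R
  proof (intro conjI ballI impI)
    show "M \<subseteq> N" using x0 by (force simp: M_def)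
    fix e f assume ef: "e \<in> M" "f \<in> M" "e \<noteq> f"
    show "{e, f} \<notin> edges R"
    proof
      assume "{e, f} \<in> edges R"
      then obtain u K where uK: "rep_index r G u K" "e \<in> rep_variables r G u K" "f \<in> rep_variables r G u K"
        by (auto simp: adjacent_iff_common)
      have "card {e, f} \<le> card (rep_variables r G u K \<inter> M)"
        by (rule card_mono) (use uK ef in auto)
      moreover have "card (rep_variables r G u K \<inter> M) \<le> 1"
        using xc[OF uK(1)] by (simp add: xM sum_incidence)
      ultimately show False using ef(3) by simp
    qed
  qed
  thus "x \<in> incidence ` {M. stable_set R M}" using xM by blast
next
  fix x assume "x \<in> incidence ` {M. stable_set R M}"
  then obtain M where M: "stable_set R M" "x = incidence M" by blast
  have "M \<subseteq> N" using M(1) by (simp add: stable_set_def verts_R)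
  moreover have "rep_constraint r G u K x" if uK: "rep_index r G u K" for u K
    using stable_clique_card[OF M(1) rep_variables_clique[OF uK]]
    by (simp add: rep_constraint_iff[OF uK] M(2) sum_incidence Int_commute)
  ultimately show "x \<in> {x \<in> nonedge_space G. (\<forall>e\<in>N. x $ e \<in> {0, 1}) \<and>
      (\<forall>u K. rep_index r G u K \<longrightarrow> rep_constraint r G u K x)}"
    using M(2) by (auto simp: nonedge_space_def incidence_nth)
qed

text \<open>The empty set and the singletons are stable, so their
  incidence vectors span the coordinate subspace.\<close>

lemma affine_hull_stable: "affine hull (incidence ` {M. stable_set R M}) = nonedge_space G"
proof -
  let ?V = "incidence ` {M. stable_set R M}"
  have sub: "subspace (nonedge_space G)" by (auto simp: subspace_def nonedge_space_def)
  have VS: "?V \<subseteq> nonedge_space G"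
    by (auto simp: nonedge_space_def incidence_nth stable_set_def verts_R)
  have "0 = incidence ({} :: 'v set set)" by (simp add: vec_eq_iff incidence_nth)
  moreover have "stable_set R {}" by (simp add: stable_set_def)
  ultimately have "0 \<in> ?V" by blast
  hence "affine hull ?V = span ?V" by (intro affine_hull_span_0 hull_inc)
  also have "span ?V = nonedge_space G"
  proof
    show "span ?V \<subseteq> nonedge_space G" using VS sub by (rule span_minimal)
    show "nonedge_space G \<subseteq> span ?V"
    proof
      fix x assume x: "x \<in> nonedge_space G"
      have "x = (\<Sum>e\<in>N. x $ e *\<^sub>R incidence {e})"
        using x by (auto simp: vec_eq_iff nonedge_space_def incidence_nth if_distrib sum.delta cong: if_cong)
      also have "\<dots> \<in> span ?V"
      proof (intro span_sum span_scale span_base)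
        fix e assume "e \<in> N"
        hence "stable_set R {e}" by (simp add: stable_set_def verts_R)
        thus "incidence {e} \<in> ?V" by blast
      qed
      finally show "x \<in> span ?V" .
    qed
  qed
  finally show ?thesis .
qed

lemma cf_bound_pos: "1 \<le> p \<Longrightarrow> p \<le> card F \<Longrightarrow> cf_bound F p > 0"
proof -
  assume p: "1 \<le> p" "p \<le> card F"
  hence "card F mod p < p" "card F div p > 0" by (simp_all add: div_greater_zero_iff)
  thus ?thesis by (simp add: cf_bound_def)
qed

lemma polytope_valid:
  assumes "x \<in> coloring_polytope r G"
  shows "x \<in> nonedge_space G \<and> (\<forall>e\<in>N. 0 \<le> x $ e) \<and>
    (\<forall>u K. rep_index r G u K \<longrightarrow> rep_constraint r G u K x) \<and>
    (\<forall>F p. (\<forall>K\<in>F. is_clique R K) \<and> 1 \<le> p \<and> p \<le> card F \<longrightarrow> clique_family_ineq R F p x)"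
proof -
  have x: "x \<in> convex hull (incidence ` {M. stable_set R M})"
    using assms unfolding coloring_polytope_def integer_points .
  have half: "a \<bullet> x \<le> b" if "\<And>M. stable_set R M \<Longrightarrow> a \<bullet> incidence M \<le> b" for a b
  proof -
    have "convex hull (incidence ` {M. stable_set R M}) \<subseteq> {x. a \<bullet> x \<le> b}"
      using that by (intro hull_minimal convex_halfspace_le) auto
    thus ?thesis using x by auto
  qed
  have "x \<in> affine hull (incidence ` {M. stable_set R M})"
    using x convex_hull_subset_affine_hull by blast
  hence 1: "x \<in> nonedge_space G" by (simp add: affine_hull_stable)
  have 2: "0 \<le> x $ e" for e
    using half[of "- axis e 1" 0] by (simp add: inner_axis' incidence_nth)
  have 3: "rep_constraint r G u K x" if uK: "rep_index r G u K" for u K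
  proof -
    have s: "(\<Sum>e\<in>rep_variables r G u K. y $ e) = incidence (rep_variables r G u K) \<bullet> y" for y :: "real ^ 'v set"
      by (simp add: inner_vec_def incidence_nth if_distrib[of "\<lambda>z. z * _"] sum.If_cases cong: if_cong)
    show ?thesis
      unfolding rep_constraint_iff[OF uK] s
    proof (rule half)
      fix M assume "stable_set R M"
      thus "incidence (rep_variables r G u K) \<bullet> incidence M \<le> 1"
        using integer_points rep_constraint_iff[OF uK] uK unfolding s[symmetric] by blast
    qed
  qed
  have 4: "clique_family_ineq R F p x" if F: "\<forall>K\<in>F. is_clique R K" "1 \<le> p" for F p
  proof -
    obtain c where c: "\<And>x. cf_value R F p x = c \<bullet> x" using cf_value_inner[of R F p] by blast
    show ?thesis unfolding clique_family_ineq_iff c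
      by (rule half) (use clique_family_valid[OF _ F] c in auto)
  qed
  show ?thesis using 1 2 3 4 by blast
qed

end

context kite_free
begin

lemma polytope_complete:
  assumes x: "x \<in> nonedge_space G" and nonneg: "\<And>e. e \<in> N \<Longrightarrow> 0 \<le> x $ e"
    and cf: "\<And>F p. \<lbrakk>\<forall>K\<in>F. is_clique R K; 1 \<le> p; p \<le> card F\<rbrakk> \<Longrightarrow> clique_family_ineq R F p x"
  shows "x \<in> coloring_polytope r G"
proof -
  define V where "V = incidence ` {M. stable_set R M}"
  define I1 where "I1 = {(- axis e 1 :: real ^ 'v set, 0::real) | e. e \<in> N}"
  define I2 where "I2 = {(c, cf_bound F p) | c F p. (\<forall>K\<in>F. is_clique R K) \<and> 1 \<le> p \<and> p \<le> card F
      \<and> (\<forall>x. cf_value R F p x = c \<bullet> x)}"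
  have "x \<in> convex hull V"
  proof (rule convex_hull_by_tight_inequalities[where I = "I1 \<union> I2" and S = "nonedge_space G"])
    show "finite V" by (simp add: V_def)
    have empty: "stable_set R {}" by (simp add: stable_set_def)
    thus "V \<noteq> {}" by (auto simp: V_def)
    show "affine hull V = nonedge_space G" unfolding V_def by (rule affine_hull_stable)
    show "a \<bullet> x \<le> b" if "(a, b) \<in> I1 \<union> I2" for a b
      using that
    proof
      assume "(a, b) \<in> I1"
      thus ?thesis using nonneg by (auto simp: I1_def inner_axis')
    next
      assume "(a, b) \<in> I2"
      then obtain F p where F: "\<forall>K\<in>F. is_clique R K" "1 \<le> p" "p \<le> card F" "cf_value R F p x = a \<bullet> x"
        "b = cf_bound F p" by (auto simp: I2_def)
      thus ?thesis using cf[OF F(1-3)] by (simp add: clique_family_ineq_iff)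
    qed
    fix y z c assume yz: "y \<in> V" "z \<in> V" "c \<bullet> y < c \<bullet> z"
    define w where "w e = c $ e" for e
    have cM: "c \<bullet> incidence M = sum w M" for M
      by (simp add: inner_vec_def incidence_nth w_def if_distrib[of "\<lambda>z. _ * z"] sum.If_cases cong: if_cong)
    have "\<exists>e\<in>N. w e \<noteq> 0"
    proof (rule ccontr)
      assume "\<not> ?thesis"
      hence "sum w M = 0" if "stable_set R M" for M
        using that by (intro sum.neutral) (auto simp: stable_set_def verts_R)
      thus False using yz cM by (auto simp: V_def)
    qed
    have opt: "max_stable R N w M" if M: "stable_set R M" "\<forall>v'\<in>V. c \<bullet> v' \<le> c \<bullet> incidence M" for M
      using M cM unfolding max_stable_def V_def by (auto simp: stable_set_def verts_R)
    from tight_inequality[OF \<open>\<exists>e\<in>N. w e \<noteq> 0\<close>]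
    show "\<exists>(a, b)\<in>I1 \<union> I2. (\<forall>v\<in>V. (\<forall>v'\<in>V. c \<bullet> v' \<le> c \<bullet> v) \<longrightarrow> a \<bullet> v = b) \<and> (\<exists>v\<in>V. a \<bullet> v < b) \<and> (\<forall>v\<in>V. a \<bullet> v \<le> b)"
    proof
      assume "\<exists>e\<in>N. \<forall>M. max_stable R N w M \<longrightarrow> e \<notin> M"
      then obtain e where e: "e \<in> N" "\<And>M. max_stable R N w M \<Longrightarrow> e \<notin> M" by blast
      have "(- axis e 1, 0) \<in> I1 \<union> I2" using e by (auto simp: I1_def)
      moreover have "\<forall>v\<in>V. (\<forall>v'\<in>V. c \<bullet> v' \<le> c \<bullet> v) \<longrightarrow> - axis e 1 \<bullet> v = 0"
        using opt e(2) by (auto simp: V_def inner_axis' incidence_nth)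
      moreover have "incidence {e} \<in> V" using e by (auto simp: V_def stable_set_def verts_R)
      hence "\<exists>v\<in>V. - axis e 1 \<bullet> v < 0" by (rule bexI[rotated]) (simp add: inner_axis' incidence_nth)
      moreover have "\<forall>v\<in>V. - axis e 1 \<bullet> v \<le> 0" by (auto simp: V_def inner_axis' incidence_nth)
      ultimately show ?thesis by blast
    next
      assume "\<exists>F p. (\<forall>K\<in>F. is_clique R K) \<and> 1 \<le> p \<and> p \<le> card F \<and>
        (\<forall>M. max_stable R N w M \<longrightarrow> cf_value R F p (incidence M) = cf_bound F p)"
      then obtain F p where F: "\<forall>K\<in>F. is_clique R K" "1 \<le> p" "p \<le> card F"
        "\<And>M. max_stable R N w M \<Longrightarrow> cf_value R F p (incidence M) = cf_bound F p" by blast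
      obtain a where a: "\<And>x. cf_value R F p x = a \<bullet> x" using cf_value_inner[of R F p] by blast
      have "(a, cf_bound F p) \<in> I1 \<union> I2" using F(1-3) a unfolding I2_def by blast
      moreover have "\<forall>v\<in>V. (\<forall>v'\<in>V. c \<bullet> v' \<le> c \<bullet> v) \<longrightarrow> a \<bullet> v = cf_bound F p"
        using opt F(4) a by (auto simp: V_def)
      moreover have "incidence {} \<in> V" using empty by (auto simp: V_def)
      moreover have "incidence {} = (0 :: real ^ 'v set)" by (simp add: vec_eq_iff incidence_nth)
      hence "a \<bullet> incidence {} < cf_bound F p" using cf_bound_pos[OF F(2,3)] by simp
      moreover have "\<forall>v\<in>V. a \<bullet> v \<le> cf_bound F p"
        using clique_family_valid[OF _ F(1,2)] a by (auto simp: V_def)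
      ultimately show ?thesis by blast
    qed
  qed (rule x)
  thus ?thesis unfolding coloring_polytope_def integer_points V_def .
qed

end

theorem theorem3p15:
  fixes G :: "'v::finite graph" and r :: "('v \<times> 'v) set"
  assumes "simple_graph G"
    and "\<not> has_subgraph (complement G) kite"
    and "strict_linear_order_on (verts G) r"
  shows "coloring_polytope r G =
    {x \<in> nonedge_space G.
       (\<forall>e\<in>edges (complement G). 0 \<le> x $ e) \<and>
       (\<forall>u K. rep_index r G u K \<longrightarrow> rep_constraint r G u K x) \<and>
       (\<forall>F p. (\<forall>K\<in>F. is_clique (rep_graph r G) K) \<and> 1 \<le> p \<and> p \<le> card F \<longrightarrow>
          clique_family_ineq (rep_graph r G) F p x)}"
proof -
  interpret kite_free G r
    by (unfold_locales) (use assms in auto)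
  show ?thesis
  proof (intro equalityI subsetI)
    fix x assume "x \<in> coloring_polytope r G"
    from polytope_valid[OF this] show "x \<in> {x \<in> nonedge_space G.
       (\<forall>e\<in>edges (complement G). 0 \<le> x $ e) \<and>
       (\<forall>u K. rep_index r G u K \<longrightarrow> rep_constraint r G u K x) \<and>
       (\<forall>F p. (\<forall>K\<in>F. is_clique (rep_graph r G) K) \<and> 1 \<le> p \<and> p \<le> card F \<longrightarrow>
          clique_family_ineq (rep_graph r G) F p x)}" by simp
  qed (rule polytope_complete, auto)
qed

end
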